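(* With the notation of the context, suppose that (i) $|\mathrm{Re}\,(\overline{\mathcal D}_{j,j})_{n,n}|>\rho_{n,j}$ for every $n\in I^{3N}$ and every $j\in\{1,\dots,p\}$, with exactly one exception $(n_0,j_0)$; (ii) $\sup_{n\in\mathcal Z_{\rm red}\setminus I^{3N}}\mathrm{Re}\,(\overline{\mathcal D}_{j,j})_{n,n}+Q_j+\mathscr r^\infty<0$ for every $j$; (iii) the disk $\{z\in\mathbb C:|z-(\overline{\mathcal D}_{j_0,j_0})_{n_0,n_0}|\le\rho_{n_0,j_0}\}$ is disjoint from all the other disks $\{z:|z-(\overline{\mathcal D}_{j,j})_{n,n}|\le\rho_{n,j}\}$, $(n,j)\ne(n_0,j_0)$. Then $D_uf(\tilde\lambda,\tilde{\mathbf u})$ has exactly one eigenvalue with zero real part, namely the algebraically simple eigenvalue $0$, and every other eigenvalue lies in $\{z:\mathrm{Re}(z)\neq0\}$. If, in addition, (iv) $\mathrm{Re}\,(\overline{\mathcal D}_{j,j})_{n,n}+\rho_{n,j}<0$ for every $n\in I^{3N}$ and every $j$ with $(n,j)\neq(n_0,j_0)$, then $k=0$, where $k$ is the number of eigenvalues of $D_uf(\tilde\lambda,\tilde{\mathbf u})$ with strictly positive real part.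
   Context: Sequences. $\mathcal G$ is a finite group acting linearly on $\mathbb Z^m$ (Fourier indices), $\mathrm{orb}(n)$ the orbit of $n$, $\mathcal Z_{\rm red}$ a set of orbit representatives, $I^K=\{n\in\mathcal Z_{\rm red}:|n|_\infty\le K\}$. A $\mathcal G$-symmetric Fourier sequence is stored as $u=(u_n)_{n\in\mathcal Z_{\rm red}}$ with unfolding $\iota(u)$ on $\mathbb Z^m$ (constant on orbits). $\|u\|_1=\sum_{n\in\mathbb Z^m}|\iota(u)_n|=\sum_{n\in\mathcal Z_{\rm red}}|\mathrm{orb}(n)||u_n|$ is the norm of $\ell^1_{\mathcal G}$ (on $p$-tuples: the sum over components). $\mathbb M_q$ is convolution by $q$ (of unfolded sequences). $\Pi^{\le N}$, $\Pi^{>N}$ are the projections onto indices in $I^N$ and its complement (applied componentwise). Problem. $f(\lambda,\mathbf u)=l_\lambda\mathbf u+g(\lambda,\mathbf u)$, $p$ equations, with $l_\lambda$ diagonal (in components and in Fourier index, with symbol from an elliptic operator, so that $D_uf$ is sectorial with compact resolvent). $(\bar\lambda,\bar{\mathbf u})$ is a numerical approximation with $\bar{\mathbf u}=\Pi^{\le N}\bar{\mathbf u}$. Write $Dg=D_ug(\bar\lambda,\bar{\mathbf u})$ and assume each block is $(Dg)_{i,j}=\mathbb M_{\bar q_{i,j}}$ with $\bar q_{i,j}$ supported in $I^{2N}$; $Q_j=\sum_{i=1}^p\|\bar q_{i,j}\|_1$. $(\tilde\lambda,\tilde{\mathbf u})$ is the exact solution obtained from a Newton–Kantorovich argument within radius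 $r_0$ of the approximation: in particular $D_uf(\tilde\lambda,\tilde{\mathbf u})\mathbf v=0$ for some $\mathbf v\neq0$. $\varepsilon_{r_0}$ is a constant with $\|D_uf(\tilde\lambda,\tilde{\mathbf u})-D_uf(\bar\lambda,\bar{\mathbf u})\|_{\mathcal B(\ell^1_{\mathcal G})}\le\varepsilon_{r_0}$. Pseudo-diagonalization. $P=P^N+\Pi^{>N}$, $P^N=\Pi^{\le N}P^N\Pi^{\le N}$ an invertible finite matrix on the range of $\Pi^{\le N}$, $P^{-1}=(P^N)^{-1}+\Pi^{>N}$. $\overline{\mathcal D}=P^{-1}D_uf(\bar\lambda,\bar{\mathbf u})P$, with component blocks $\overline{\mathcal D}_{i,j}$, each a matrix indexed by $\mathcal Z_{\rm red}$. Radii. $\mathscr r^\infty=\max(1,\|P^N\|_{\mathcal B(\ell^1_{\mathcal G})})\max(1,\|(P^N)^{-1}\|_{\mathcal B(\ell^1_{\mathcal G})})\varepsilon_{r_0}$; for $n\in I^N$: $\bar{\mathscr r}^{\le N}_{n,j}=\frac1{|\mathrm{orb}(n)|}\Big(\sum_{k\in I^N,\,1\le i\le p,\,(k,i)\ne(n,j)}|(\overline{\mathcal D}_{i,j})_{k,n}||\mathrm{orb}(k)|+\sum_{k\in I^{3N}\setminus I^N}\sum_{i=1}^p|((Dg\,P^N)_{i,j})_{k,n}||\mathrm{orb}(k)|\Big)$; for $n\in I^{3N}\setminus I^N$: $\bar{\mathscr r}^{3N\setminus N}_{n,j}=\frac1{|\mathrm{orb}(n)|}\sum_{k\in I^N}\sum_{i=1}^p|(((P^N)^{-1}Dg)_{i,j})_{k,n}||\mathrm{orb}(k)|+Q_j$.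 $\rho_{n,j}=\bar{\mathscr r}^{\le N}_{n,j}+\mathscr r^\infty$ if $n\in I^N$; $\rho_{n,j}=\bar{\mathscr r}^{3N\setminus N}_{n,j}+\mathscr r^\infty$ if $n\in I^{3N}\setminus I^N$; $\rho_{n,j}=Q_j+\mathscr r^\infty$ if $n\notin I^{3N}$.
   Formalization: Added assumption: sums and differences of an index in the orbits of I^N and one in the orbits of I^{2N} lie in the orbits of I^{3N}. It is automatic if the group preserves |n|_∞; without it the radii can miss matrix entries and the claim can fail. *)

theory Defs
  imports "HOL-Analysis.Analysis" "HOL-Algebra.Group_Action"
begin

section \<open>The sequence space\<close>

typedef 'i ell1 = "{u :: 'i \<Rightarrow> complex. (\<lambda>i. cmod (u i)) summable_on UNIV}"
  morphisms fcoeff Abs_ell1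
  by (rule exI[of _ "\<lambda>_. 0"]) simp

setup_lifting type_definition_ell1

lemma fcoeff_summable: "(\<lambda>i. cmod (fcoeff u i)) summable_on UNIV"
  using fcoeff[of u] by simp

lemma ell1_eqI: "(\<And>i. fcoeff u i = fcoeff v i) \<Longrightarrow> u = v"
  by (simp add: fcoeff_inject[symmetric] fun_eq_iff)

instantiation ell1 :: (type) real_normed_vector
begin

lift_definition zero_ell1 :: "'a ell1" is "\<lambda>_. 0"
  by simp

lift_definition plus_ell1 :: "'a ell1 \<Rightarrow> 'a ell1 \<Rightarrow> 'a ell1" is "\<lambda>u v i. u i + v i"
proof -
  fix u v :: "'a \<Rightarrow> complex"
  assume "(\<lambda>i. cmod (u i)) summable_on UNIV" "(\<lambda>i. cmod (v i)) summable_on UNIV"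
  then have "(\<lambda>i. cmod (u i) + cmod (v i)) summable_on UNIV" by (rule summable_on_add)
  then show "(\<lambda>i. cmod (u i + v i)) summable_on UNIV"
    by (rule Infinite_Sum.abs_summable_on_comparison_test') (rule norm_triangle_ineq)
qed

lift_definition uminus_ell1 :: "'a ell1 \<Rightarrow> 'a ell1" is "\<lambda>u i. - u i"
  by simp

lift_definition minus_ell1 :: "'a ell1 \<Rightarrow> 'a ell1 \<Rightarrow> 'a ell1" is "\<lambda>u v i. u i - v i"
proof -
  fix u v :: "'a \<Rightarrow> complex"
  assume "(\<lambda>i. cmod (u i)) summable_on UNIV" "(\<lambda>i. cmod (v i)) summable_on UNIV"
  then have "(\<lambda>i. cmod (u i) + cmod (v i)) summable_on UNIV" by (rule summable_on_add)
  then show "(\<lambda>i. cmod (u i - v i)) summable_on UNIV"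
    by (rule Infinite_Sum.abs_summable_on_comparison_test') (rule norm_triangle_ineq4)
qed

lift_definition scaleR_ell1 :: "real \<Rightarrow> 'a ell1 \<Rightarrow> 'a ell1" is "\<lambda>r u i. r *\<^sub>R u i"
  by (simp add: summable_on_cmult_right)

definition norm_ell1 :: "'a ell1 \<Rightarrow> real" where
  "norm_ell1 u = (\<Sum>\<^sub>\<infinity>i. cmod (fcoeff u i))"

definition dist_ell1 :: "'a ell1 \<Rightarrow> 'a ell1 \<Rightarrow> real" where
  "dist_ell1 u v = norm (u - v)"

definition sgn_ell1 :: "'a ell1 \<Rightarrow> 'a ell1" where
  "sgn_ell1 u = inverse (norm u) *\<^sub>R u"

definition uniformity_ell1 :: "('a ell1 \<times> 'a ell1) filter" where
  "uniformity_ell1 = (INF e\<in>{0 <..}. principal {(x, y). dist x y < e})"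

definition open_ell1 :: "'a ell1 set \<Rightarrow> bool" where
  "open_ell1 S = (\<forall>x\<in>S. \<forall>\<^sub>F (x', y) in uniformity. x' = x \<longrightarrow> y \<in> S)"

instance
proof
  fix u v w :: "'a ell1" and a b :: real
  show "u + v + w = u + (v + w)" by (transfer, simp add: add.assoc)
  show "u + v = v + u" by (transfer, simp add: add.commute)
  show "0 + u = u" by (transfer, simp)
  show "- u + u = 0" by (transfer, simp)
  show "u - v = u + - v" by (transfer, simp)
  show "a *\<^sub>R (u + v) = a *\<^sub>R u + a *\<^sub>R v" by (transfer, simp add: scaleR_add_right)
  show "(a + b) *\<^sub>R u = a *\<^sub>R u + b *\<^sub>R u" by (transfer, simp add: scaleR_add_left)
  show "a *\<^sub>R b *\<^sub>R u = (a * b) *\<^sub>R u" by (transfer, simp)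
  show "1 *\<^sub>R u = u" by (transfer, simp)
  show "dist u v = norm (u - v)" by (rule dist_ell1_def)
  show "sgn u = inverse (norm u) *\<^sub>R u" by (rule sgn_ell1_def)
  show "(uniformity :: ('a ell1 \<times> 'a ell1) filter) = (INF e\<in>{0 <..}. principal {(x, y). dist x y < e})"
    by (rule uniformity_ell1_def)
  show "open S = (\<forall>x\<in>S. \<forall>\<^sub>F (x', y) in uniformity. x' = x \<longrightarrow> y \<in> S)" for S :: "'a ell1 set"
    by (rule open_ell1_def)
  show "(norm u = 0) = (u = 0)"
  proof
    assume "norm u = 0"
    then have "cmod (fcoeff u i) = 0" for i
      using nonneg_infsum_le_0D[OF _ fcoeff_summable, of u i] by (simp add: norm_ell1_def)
    then show "u = 0" by (intro ell1_eqI) (simp add: zero_ell1.rep_eq)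
  qed (simp add: norm_ell1_def zero_ell1.rep_eq)
  show "norm (u + v) \<le> norm u + norm v"
    unfolding norm_ell1_def infsum_add[OF fcoeff_summable fcoeff_summable, symmetric]
    by (intro infsum_mono fcoeff_summable summable_on_add)
       (simp add: plus_ell1.rep_eq norm_triangle_ineq)
  show "norm (a *\<^sub>R u) = \<bar>a\<bar> * norm u"
    by (simp add: norm_ell1_def scaleR_ell1.rep_eq infsum_cmult_right')
qed

end

lift_definition cscale :: "complex \<Rightarrow> 'i ell1 \<Rightarrow> 'i ell1" (infixr "*\<^sub>C" 75) is "\<lambda>c u i. c * u i"
  by (simp add: norm_mult summable_on_cmult_right)

interpretation ell1: vector_space "(*\<^sub>C)"
  by standard (transfer; simp add: algebra_simps)+


section \<open>Symmetric Fourier sequences\<close>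

type_synonym 'm freq = "int ^ 'm"

text \<open>
  A symmetric sequence is represented by its unfolding, a sequence on the whole lattice that is
  constant on orbits; its reduced coordinates are the values at the orbit representatives.  The
  norm inherited from the type is then the norm of the unfolding (see \<open>norm_sym_ell1\<close> below for
  the orbit-weighted form).  Tuples are indexed by pairs (component, frequency).
\<close>

definition linear_lattice_action :: "('g, 'b) monoid_scheme \<Rightarrow> ('g \<Rightarrow> 'm::finite freq \<Rightarrow> 'm freq) \<Rightarrow> bool"
  where "linear_lattice_action G \<phi> \<longleftrightarrow>
    group_action G UNIV \<phi> \<and> finite (carrier G) \<and>
    (\<forall>h\<in>carrier G. \<forall>a b. \<phi> h (a + b) = \<phi> h a + \<phi> h b)"

definition orbit_representatives ::
    "('g, 'b) monoid_scheme \<Rightarrow> ('g \<Rightarrow> 'm::finite freq \<Rightarrow> 'm freq) \<Rightarrow> 'm freq set \<Rightarrow> bool"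
  where "orbit_representatives G \<phi> Z \<longleftrightarrow> (\<forall>n. \<exists>!r. r \<in> Z \<and> r \<in> orbit G \<phi> n)"

definition orbit_constant ::
    "('g, 'b) monoid_scheme \<Rightarrow> ('g \<Rightarrow> 'm::finite freq \<Rightarrow> 'm freq) \<Rightarrow> ('m freq \<Rightarrow> complex) \<Rightarrow> bool"
  where "orbit_constant G \<phi> a \<longleftrightarrow> (\<forall>h\<in>carrier G. \<forall>n. a (\<phi> h n) = a n)"

definition sym_ell1 ::
    "('g, 'b) monoid_scheme \<Rightarrow> ('g \<Rightarrow> 'm::finite freq \<Rightarrow> 'm freq) \<Rightarrow> ('p \<times> 'm freq) ell1 set"
  where "sym_ell1 G \<phi> = {u. \<forall>j. orbit_constant G \<phi> (\<lambda>n. fcoeff u (j, n))}"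

definition sup_norm :: "'m::finite freq \<Rightarrow> int" where
  "sup_norm n = Max (range (\<lambda>i. \<bar>n $ i\<bar>))"

definition idx :: "'m::finite freq set \<Rightarrow> nat \<Rightarrow> 'm freq set" where
  "idx Z K = {n \<in> Z. sup_norm n \<le> int K}"

definition unfold_set ::
    "('g, 'b) monoid_scheme \<Rightarrow> ('g \<Rightarrow> 'm::finite freq \<Rightarrow> 'm freq) \<Rightarrow> 'm freq set \<Rightarrow> 'm freq set"
  where "unfold_set G \<phi> S = (\<Union>n\<in>S. orbit G \<phi> n)"

text \<open>
  Compatibility of the index sets with the group action: convolution by a sequence supported in
  \<open>idx Z (2 * N)\<close> couples the indices of \<open>idx Z N\<close> only to those of \<open>idx Z (3 * N)\<close>.  This is automatic when
  the action preserves the sup norm (see \<open>cutoff_compatible_if_isometric\<close>), but it can fail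
  otherwise, and then the finite sums in the radii miss matrix entries.
\<close>

definition cutoff_compatible ::
    "('g, 'b) monoid_scheme \<Rightarrow> ('g \<Rightarrow> 'm::finite freq \<Rightarrow> 'm freq) \<Rightarrow> 'm freq set \<Rightarrow> nat \<Rightarrow> bool"
  where "cutoff_compatible G \<phi> Z N \<longleftrightarrow>
    (\<forall>n\<in>unfold_set G \<phi> (idx Z N). \<forall>a\<in>unfold_set G \<phi> (idx Z (2 * N)).
       n + a \<in> unfold_set G \<phi> (idx Z (3 * N)) \<and> n - a \<in> unfold_set G \<phi> (idx Z (3 * N)))"

definition proj ::
    "('g, 'b) monoid_scheme \<Rightarrow> ('g \<Rightarrow> 'm::finite freq \<Rightarrow> 'm freq) \<Rightarrow> 'm freq set \<Rightarrow>
     ('p \<times> 'm freq) ell1 \<Rightarrow> ('p \<times> 'm freq) ell1"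
  where "proj G \<phi> S u =
    Abs_ell1 (\<lambda>(j, n). if n \<in> unfold_set G \<phi> S then fcoeff u (j, n) else 0)"

text \<open>The unfolding of the \<open>n\<close>-th reduced unit sequence, placed in component \<open>j\<close>.\<close>

definition orb_unit ::
    "('g, 'b) monoid_scheme \<Rightarrow> ('g \<Rightarrow> 'm::finite freq \<Rightarrow> 'm freq) \<Rightarrow> 'p \<Rightarrow> 'm freq \<Rightarrow> ('p \<times> 'm freq) ell1"
  where "orb_unit G \<phi> j n = Abs_ell1 (\<lambda>(i, k). if i = j \<and> k \<in> orbit G \<phi> n then 1 else 0)"

text \<open>The entry \<open>(A\<^sub>i\<^sub>,\<^sub>j)\<^sub>k\<^sub>,\<^sub>n\<close>, for representatives \<open>k\<close> and \<open>n\<close>.\<close>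

definition entry ::
    "('g, 'b) monoid_scheme \<Rightarrow> ('g \<Rightarrow> 'm::finite freq \<Rightarrow> 'm freq) \<Rightarrow>
     (('p \<times> 'm freq) ell1 \<Rightarrow> ('p \<times> 'm freq) ell1) \<Rightarrow> 'p \<Rightarrow> 'p \<Rightarrow> 'm freq \<Rightarrow> 'm freq \<Rightarrow> complex"
  where "entry G \<phi> A i j k n = fcoeff (A (orb_unit G \<phi> j n)) (i, k)"

definition conv :: "('m::finite freq \<Rightarrow> complex) \<Rightarrow> ('m freq \<Rightarrow> complex) \<Rightarrow> 'm freq \<Rightarrow> complex" where
  "conv a b k = (\<Sum>\<^sub>\<infinity>n. a (k - n) * b n)"


section \<open>Operators\<close>

definition clinear_on :: "'i ell1 set \<Rightarrow> ('i ell1 \<Rightarrow> 'i ell1) \<Rightarrow> bool" where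
  "clinear_on X A \<longleftrightarrow>
     (\<forall>u\<in>X. \<forall>v\<in>X. A (u + v) = A u + A v) \<and> (\<forall>c. \<forall>u\<in>X. A (c *\<^sub>C u) = c *\<^sub>C A u)"

definition onorm_on :: "'i ell1 set \<Rightarrow> ('i ell1 \<Rightarrow> 'i ell1) \<Rightarrow> real" where
  "onorm_on X A = (SUP u\<in>X. norm (A u) / norm u)"

text \<open>A linear operator on \<open>X\<close> which is a finite matrix on the range of the projection \<open>pr\<close> and is
  extended by zero.\<close>

definition finite_block :: "'i ell1 set \<Rightarrow> ('i ell1 \<Rightarrow> 'i ell1) \<Rightarrow> ('i ell1 \<Rightarrow> 'i ell1) \<Rightarrow> bool" where
  "finite_block X pr A \<longleftrightarrow> clinear_on X A \<and> A ` X \<subseteq> X \<and> (\<forall>u\<in>X. A u = pr (A (pr u)))"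

text \<open>The (unbounded) diagonal operator with symbol \<open>L\<close>, and its maximal domain in \<open>X\<close>.\<close>

definition diag_dom :: "('p \<times> 'n) ell1 set \<Rightarrow> ('p \<Rightarrow> 'n \<Rightarrow> complex) \<Rightarrow> ('p \<times> 'n) ell1 set" where
  "diag_dom X L = {v \<in> X. (\<lambda>(j, n). cmod (L j n * fcoeff v (j, n))) summable_on UNIV}"

definition diag_op :: "('p \<Rightarrow> 'n \<Rightarrow> complex) \<Rightarrow> ('p \<times> 'n) ell1 \<Rightarrow> ('p \<times> 'n) ell1" where
  "diag_op L v = Abs_ell1 (\<lambda>(j, n). L j n * fcoeff v (j, n))"

definition lin_op ::
    "('p \<Rightarrow> 'n \<Rightarrow> complex) \<Rightarrow> (('p \<times> 'n) ell1 \<Rightarrow> ('p \<times> 'n) ell1) \<Rightarrow> ('p \<times> 'n) ell1 \<Rightarrow> ('p \<times> 'n) ell1"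
  where "lin_op L B = (\<lambda>v. diag_op L v + B v)"

text \<open>Below, an unbounded operator on the subspace \<open>X\<close> is given by its domain \<open>D\<close> and a function \<open>A\<close>,
  whose values outside \<open>D\<close> are irrelevant.\<close>

definition is_resolvent ::
    "'i ell1 set \<Rightarrow> 'i ell1 set \<Rightarrow> ('i ell1 \<Rightarrow> 'i ell1) \<Rightarrow> complex \<Rightarrow> ('i ell1 \<Rightarrow> 'i ell1) \<Rightarrow> bool"
  where "is_resolvent X D A z R \<longleftrightarrow>
    (\<forall>v\<in>X. R v \<in> D \<and> z *\<^sub>C R v - A (R v) = v) \<and> (\<forall>v\<in>D. R (z *\<^sub>C v - A v) = v) \<and>
    (\<exists>C. \<forall>v\<in>X. norm (R v) \<le> C * norm v)"

definition compact_resolvent :: "'i ell1 set \<Rightarrow> 'i ell1 set \<Rightarrow> ('i ell1 \<Rightarrow> 'i ell1) \<Rightarrow> bool" where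
  "compact_resolvent X D A \<longleftrightarrow>
     (\<exists>z R. is_resolvent X D A z R \<and> compact (closure (R ` (X \<inter> cball 0 1))))"

text \<open>Sign convention: sectorial operators are generators of analytic semigroups, i.e. the
  complement of the sector contains the spectrum and opens to the left.\<close>

definition sectorial :: "'i ell1 set \<Rightarrow> 'i ell1 set \<Rightarrow> ('i ell1 \<Rightarrow> 'i ell1) \<Rightarrow> bool" where
  "sectorial X D A \<longleftrightarrow>
     (\<exists>(\<omega>::real) (\<theta>::real) M. pi / 2 < \<theta> \<and> \<theta> < pi \<and>
       (\<forall>z. z \<noteq> of_real \<omega> \<and> \<bar>Arg (z - of_real \<omega>)\<bar> < \<theta> \<longrightarrow>
          (\<exists>R. is_resolvent X D A z R \<and> (\<forall>v\<in>X. norm (R v) \<le> M / cmod (z - of_real \<omega>) * norm v))))"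

definition eigenvalues :: "'i ell1 set \<Rightarrow> ('i ell1 \<Rightarrow> 'i ell1) \<Rightarrow> complex set" where
  "eigenvalues D A = {z. \<exists>v\<in>D. v \<noteq> 0 \<and> A v = z *\<^sub>C v}"

primrec ker_pow :: "'i ell1 set \<Rightarrow> ('i ell1 \<Rightarrow> 'i ell1) \<Rightarrow> complex \<Rightarrow> nat \<Rightarrow> 'i ell1 set" where
  "ker_pow D A z 0 = {0}"
| "ker_pow D A z (Suc k) = {v \<in> D. A v - z *\<^sub>C v \<in> ker_pow D A z k}"

definition algebraically_simple :: "'i ell1 set \<Rightarrow> ('i ell1 \<Rightarrow> 'i ell1) \<Rightarrow> complex \<Rightarrow> bool" where
  "algebraically_simple D A z \<longleftrightarrow> ell1.dim (\<Union>k. ker_pow D A z k) = 1"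


section \<open>Pseudo-diagonalization and Gershgorin radii\<close>

text \<open>Throughout, \<open>PN\<close> and \<open>PN'\<close> stand for \<open>P\<^sup>N\<close> and its inverse on the range of the low projection,
  both extended by zero.\<close>

definition extend_block ::
    "('g, 'b) monoid_scheme \<Rightarrow> ('g \<Rightarrow> 'm::finite freq \<Rightarrow> 'm freq) \<Rightarrow> 'm freq set \<Rightarrow> nat \<Rightarrow>
     (('p \<times> 'm freq) ell1 \<Rightarrow> ('p \<times> 'm freq) ell1) \<Rightarrow> (('p \<times> 'm freq) ell1 \<Rightarrow> ('p \<times> 'm freq) ell1)"
  where "extend_block G \<phi> Z N B = (\<lambda>v. B v + proj G \<phi> (Z - idx Z N) v)"

definition pseudo_diag ::
    "('g, 'b) monoid_scheme \<Rightarrow> ('g \<Rightarrow> 'm::finite freq \<Rightarrow> 'm freq) \<Rightarrow> 'm freq set \<Rightarrow> nat \<Rightarrow>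
     (('p \<times> 'm freq) ell1 \<Rightarrow> ('p \<times> 'm freq) ell1) \<Rightarrow>
     (('p \<times> 'm freq) ell1 \<Rightarrow> ('p \<times> 'm freq) ell1) \<Rightarrow>
     (('p \<times> 'm freq) ell1 \<Rightarrow> ('p \<times> 'm freq) ell1) \<Rightarrow> (('p \<times> 'm freq) ell1 \<Rightarrow> ('p \<times> 'm freq) ell1)"
  where "pseudo_diag G \<phi> Z N PN PN' A =
    (\<lambda>v. extend_block G \<phi> Z N PN' (A (extend_block G \<phi> Z N PN v)))"

definition col_norm :: "('p::finite \<Rightarrow> 'p \<Rightarrow> 'n ell1) \<Rightarrow> 'p \<Rightarrow> real" where
  "col_norm q j = (\<Sum>i\<in>UNIV. norm (q i j))"

definition radius_inf ::
    "('g, 'b) monoid_scheme \<Rightarrow> ('g \<Rightarrow> 'm::finite freq \<Rightarrow> 'm freq) \<Rightarrow>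
     (('p \<times> 'm freq) ell1 \<Rightarrow> ('p \<times> 'm freq) ell1) \<Rightarrow>
     (('p \<times> 'm freq) ell1 \<Rightarrow> ('p \<times> 'm freq) ell1) \<Rightarrow> real \<Rightarrow> real"
  where "radius_inf G \<phi> PN PN' eps =
    max 1 (onorm_on (sym_ell1 G \<phi>) PN) * max 1 (onorm_on (sym_ell1 G \<phi>) PN') * eps"

definition radius_low ::
    "('g, 'b) monoid_scheme \<Rightarrow> ('g \<Rightarrow> 'm::finite freq \<Rightarrow> 'm freq) \<Rightarrow> 'm freq set \<Rightarrow> nat \<Rightarrow>
     (('p \<times> 'm freq) ell1 \<Rightarrow> ('p \<times> 'm freq) ell1) \<Rightarrow>
     (('p \<times> 'm freq) ell1 \<Rightarrow> ('p \<times> 'm freq) ell1) \<Rightarrow>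
     (('p \<times> 'm freq) ell1 \<Rightarrow> ('p \<times> 'm freq) ell1) \<Rightarrow>
     (('p \<times> 'm freq) ell1 \<Rightarrow> ('p \<times> 'm freq) ell1) \<Rightarrow> 'm freq \<Rightarrow> 'p::finite \<Rightarrow> real"
  where "radius_low G \<phi> Z N PN PN' A Dg n j =
    1 / real (card (orbit G \<phi> n)) *
      ((\<Sum>(k, i) \<in> idx Z N \<times> UNIV - {(n, j)}.
          cmod (entry G \<phi> (pseudo_diag G \<phi> Z N PN PN' A) i j k n) * real (card (orbit G \<phi> k))) +
       (\<Sum>k \<in> idx Z (3 * N) - idx Z N. \<Sum>i\<in>UNIV.
          cmod (entry G \<phi> (\<lambda>v. Dg (PN v)) i j k n) * real (card (orbit G \<phi> k))))"

definition radius_mid ::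
    "('g, 'b) monoid_scheme \<Rightarrow> ('g \<Rightarrow> 'm::finite freq \<Rightarrow> 'm freq) \<Rightarrow> 'm freq set \<Rightarrow> nat \<Rightarrow>
     (('p \<times> 'm freq) ell1 \<Rightarrow> ('p \<times> 'm freq) ell1) \<Rightarrow>
     (('p \<times> 'm freq) ell1 \<Rightarrow> ('p \<times> 'm freq) ell1) \<Rightarrow>
     ('p \<Rightarrow> 'p \<Rightarrow> 'm freq ell1) \<Rightarrow> 'm freq \<Rightarrow> 'p::finite \<Rightarrow> real"
  where "radius_mid G \<phi> Z N PN' Dg q n j =
    1 / real (card (orbit G \<phi> n)) *
      (\<Sum>k \<in> idx Z N. \<Sum>i\<in>UNIV.
          cmod (entry G \<phi> (\<lambda>v. PN' (Dg v)) i j k n) * real (card (orbit G \<phi> k))) + col_norm q j"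

definition gershgorin_radius ::
    "('g, 'b) monoid_scheme \<Rightarrow> ('g \<Rightarrow> 'm::finite freq \<Rightarrow> 'm freq) \<Rightarrow> 'm freq set \<Rightarrow> nat \<Rightarrow>
     (('p \<times> 'm freq) ell1 \<Rightarrow> ('p \<times> 'm freq) ell1) \<Rightarrow>
     (('p \<times> 'm freq) ell1 \<Rightarrow> ('p \<times> 'm freq) ell1) \<Rightarrow>
     (('p \<times> 'm freq) ell1 \<Rightarrow> ('p \<times> 'm freq) ell1) \<Rightarrow>
     (('p \<times> 'm freq) ell1 \<Rightarrow> ('p \<times> 'm freq) ell1) \<Rightarrow>
     ('p \<Rightarrow> 'p \<Rightarrow> 'm freq ell1) \<Rightarrow> real \<Rightarrow> 'm freq \<Rightarrow> 'p::finite \<Rightarrow> real"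
  where "gershgorin_radius G \<phi> Z N PN PN' A Dg q eps n j =
    (if n \<in> idx Z N then radius_low G \<phi> Z N PN PN' A Dg n j
     else if n \<in> idx Z (3 * N) then radius_mid G \<phi> Z N PN' Dg q n j
     else col_norm q j) + radius_inf G \<phi> PN PN' eps"

definition gershgorin_center ::
    "('g, 'b) monoid_scheme \<Rightarrow> ('g \<Rightarrow> 'm::finite freq \<Rightarrow> 'm freq) \<Rightarrow> 'm freq set \<Rightarrow> nat \<Rightarrow>
     (('p \<times> 'm freq) ell1 \<Rightarrow> ('p \<times> 'm freq) ell1) \<Rightarrow>
     (('p \<times> 'm freq) ell1 \<Rightarrow> ('p \<times> 'm freq) ell1) \<Rightarrow>
     (('p \<times> 'm freq) ell1 \<Rightarrow> ('p \<times> 'm freq) ell1) \<Rightarrow> 'm freq \<Rightarrow> 'p \<Rightarrow> complex"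
  where "gershgorin_center G \<phi> Z N PN PN' A n j = entry G \<phi> (pseudo_diag G \<phi> Z N PN PN' A) j j n n"


section \<open>Sanity checks\<close>

lemma linear_lattice_action_orbit_finite:
  assumes "linear_lattice_action G \<phi>"
  shows "finite (orbit G \<phi> n)"
proof -
  have "orbit G \<phi> n = (\<lambda>h. \<phi> h n) ` carrier G" by (auto simp: orbit_def)
  with assms show ?thesis by (simp add: linear_lattice_action_def)
qed

lemma fcoeff_orb_unit:
  assumes "linear_lattice_action G \<phi>"
  shows "fcoeff (orb_unit G \<phi> j n) (i, k) = (if i = j \<and> k \<in> orbit G \<phi> n then 1 else 0)"
proof -
  have "(\<lambda>x. cmod (case x of (i, k) \<Rightarrow> if i = j \<and> k \<in> orbit G \<phi> n then 1 else 0))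
      summable_on {j} \<times> orbit G \<phi> n"
    by (rule summable_on_finite) (simp add: linear_lattice_action_orbit_finite[OF assms])
  then have "(\<lambda>x. cmod (case x of (i, k) \<Rightarrow> if i = j \<and> k \<in> orbit G \<phi> n then 1 else 0))
      summable_on UNIV"
    by (rule summable_on_cong_neutral[THEN iffD1, rotated -1]) (auto split: if_splits)
  then show ?thesis by (simp add: orb_unit_def Abs_ell1_inverse)
qed

lemma fcoeff_proj:
  "fcoeff (proj G \<phi> S u) (j, n) = (if n \<in> unfold_set G \<phi> S then fcoeff u (j, n) else 0)"
proof -
  have "(\<lambda>x. cmod (case x of (j, n) \<Rightarrow> if n \<in> unfold_set G \<phi> S then fcoeff u (j, n) else 0))
      summable_on UNIV"
    by (rule Infinite_Sum.abs_summable_on_comparison_test'[OF fcoeff_summable[of u]]) auto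
  then show ?thesis by (simp add: proj_def Abs_ell1_inverse)
qed

lemma fcoeff_diag_op:
  assumes "v \<in> diag_dom X L"
  shows "fcoeff (diag_op L v) (j, n) = L j n * fcoeff v (j, n)"
  using assms by (simp add: diag_op_def diag_dom_def Abs_ell1_inverse case_prod_unfold)

lemma norm_sym_ell1:
  fixes u :: "('p::finite \<times> 'm::finite freq) ell1"
  assumes act: "linear_lattice_action G \<phi>" and reps: "orbit_representatives G \<phi> Z"
    and u: "u \<in> sym_ell1 G \<phi>"
  shows "norm u = (\<Sum>j\<in>UNIV. \<Sum>\<^sub>\<infinity>n\<in>Z. real (card (orbit G \<phi> n)) * cmod (fcoeff u (j, n)))"
proof -
  interpret group_action G UNIV \<phi> using act by (simp add: linear_lattice_action_def)
  let ?c = "\<lambda>j n. cmod (fcoeff u (j, n))"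
  have summ: "(\<lambda>(j, n). ?c j n) summable_on UNIV \<times> UNIV"
    using fcoeff_summable[of u] by (simp add: case_prod_unfold)
  have bij: "bij_betw snd (SIGMA r:Z. orbit G \<phi> r) UNIV"
  proof (rule bij_betwI')
    fix x y assume xy: "x \<in> (SIGMA r:Z. orbit G \<phi> r)" "y \<in> (SIGMA r:Z. orbit G \<phi> r)"
    have mem: "r \<in> orbit G \<phi> n" if "n \<in> orbit G \<phi> r" for r n :: "'m freq"
      using that orbit_sym[of r n] by simp
    show "(snd x = snd y) = (x = y)"
    proof
      assume eq: "snd x = snd y"
      with xy have "fst x \<in> Z \<and> fst x \<in> orbit G \<phi> (snd x)" "fst y \<in> Z \<and> fst y \<in> orbit G \<phi> (snd x)"
        by (auto intro: mem)
      then have "fst x = fst y" using reps unfolding orbit_representatives_def by blast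
      with eq show "x = y" by (simp add: prod_eq_iff)
    qed simp
  next
    fix n :: "'m freq"
    obtain r where "r \<in> Z" "r \<in> orbit G \<phi> n"
      using reps unfolding orbit_representatives_def by blast
    then show "\<exists>x\<in>SIGMA r:Z. orbit G \<phi> r. n = snd x"
      using orbit_sym[of n r] by (intro bexI[of _ "(r, n)"]) auto
  qed simp
  have "(\<Sum>\<^sub>\<infinity>n. ?c j n) = (\<Sum>\<^sub>\<infinity>n\<in>Z. real (card (orbit G \<phi> n)) * ?c j n)" for j
  proof -
    have "(\<lambda>n. ?c j n) summable_on UNIV"
      using summable_on_SigmaD1[OF summ, of j] by simp
    then have "(\<lambda>x. ?c j (snd x)) summable_on (SIGMA r:Z. orbit G \<phi> r)"
      using summable_on_reindex_bij_betw[OF bij, of "?c j"] by simp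
    then have "(\<Sum>\<^sub>\<infinity>n. ?c j n) = (\<Sum>\<^sub>\<infinity>r\<in>Z. \<Sum>\<^sub>\<infinity>n\<in>orbit G \<phi> r. ?c j n)"
      using infsum_reindex_bij_betw[OF bij, of "?c j"]
        infsum_Sigma_banach[of "\<lambda>x. ?c j (snd x)" Z "orbit G \<phi>"] by simp
    also have "\<dots> = (\<Sum>\<^sub>\<infinity>n\<in>Z. real (card (orbit G \<phi> n)) * ?c j n)"
    proof (rule infsum_cong)
      fix r assume "r \<in> Z"
      have "?c j n = ?c j r" if "n \<in> orbit G \<phi> r" for n
        using that u by (auto simp: orbit_def sym_ell1_def orbit_constant_def)
      then show "(\<Sum>\<^sub>\<infinity>n\<in>orbit G \<phi> r. ?c j n) = real (card (orbit G \<phi> r)) * ?c j r"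
        by (simp add: linear_lattice_action_orbit_finite[OF act])
    qed
    finally show ?thesis .
  qed
  moreover have "norm u = (\<Sum>\<^sub>\<infinity>j. \<Sum>\<^sub>\<infinity>n. ?c j n)"
    using infsum_Sigma'_banach[OF summ] by (simp add: norm_ell1_def case_prod_unfold)
  ultimately show ?thesis by simp
qed

lemma sup_norm_le_iff: "sup_norm n \<le> c \<longleftrightarrow> (\<forall>i. \<bar>n $ i\<bar> \<le> c)"
  by (auto simp: sup_norm_def)

lemma finite_idx: "finite (idx Z K)"
proof -
  have "idx Z K \<subseteq> vec_lambda ` (UNIV \<rightarrow>\<^sub>E {- int K .. int K})"
  proof
    fix n assume "n \<in> idx Z K"
    then have "\<bar>n $ i\<bar> \<le> int K" for i by (simp add: idx_def sup_norm_le_iff)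
    then have "vec_nth n \<in> UNIV \<rightarrow>\<^sub>E {- int K .. int K}" by (auto simp: abs_le_iff minus_le_iff)
    then show "n \<in> vec_lambda ` (UNIV \<rightarrow>\<^sub>E {- int K .. int K})"
      by (metis imageI vec_nth_inverse)
  qed
  then show ?thesis by (rule finite_subset) (simp add: finite_PiE)
qed

lemma cutoff_compatible_if_isometric:
  assumes "linear_lattice_action G \<phi>" and "orbit_representatives G \<phi> Z"
    and iso: "\<And>h n. h \<in> carrier G \<Longrightarrow> sup_norm (\<phi> h n) = sup_norm n"
  shows "cutoff_compatible G \<phi> Z N"
proof -
  interpret group_action G UNIV \<phi> using assms(1) by (simp add: linear_lattice_action_def)
  have unfold: "n \<in> unfold_set G \<phi> (idx Z K) \<longleftrightarrow> sup_norm n \<le> int K" for n K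
  proof
    assume "n \<in> unfold_set G \<phi> (idx Z K)"
    then show "sup_norm n \<le> int K" by (auto simp: unfold_set_def idx_def orbit_def iso)
  next
    assume n: "sup_norm n \<le> int K"
    obtain r where r: "r \<in> Z" "r \<in> orbit G \<phi> n"
      using assms(2) unfolding orbit_representatives_def by blast
    then have "sup_norm r \<le> int K" using n by (auto simp: orbit_def iso)
    moreover have "n \<in> orbit G \<phi> r" using r(2) orbit_sym[of n r] by simp
    ultimately show "n \<in> unfold_set G \<phi> (idx Z K)"
      using r(1) by (auto simp: unfold_set_def idx_def)
  qed
  have "sup_norm (n + a) \<le> int (3 * N) \<and> sup_norm (n - a) \<le> int (3 * N)"
    if "sup_norm n \<le> int N" "sup_norm a \<le> int (2 * N)" for n a
  proof -
    have le: "\<bar>n $ i\<bar> \<le> int N" "\<bar>a $ i\<bar> \<le> 2 * int N" for i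
      using that by (simp_all add: sup_norm_le_iff)
    have "\<bar>n $ i + a $ i\<bar> \<le> 3 * int N \<and> \<bar>n $ i - a $ i\<bar> \<le> 3 * int N" for i
      using le[of i] by arith
    then show ?thesis by (simp add: sup_norm_le_iff)
  qed
  then show ?thesis unfolding cutoff_compatible_def Ball_def unfold by blast
qed

end

theory Submission
  imports Defs
begin

text \<open>
  Conjugating by \<open>P\<close> turns the exact linearization into \<open>D + R\<close> with \<open>D\<close> diagonal and
  \<open>\<parallel>R v\<parallel> \<le> \<Sum>\<^sub>n \<rho>\<^sub>n |v\<^sub>n|\<close>; comparing this with \<open>\<parallel>(z - D) v\<parallel>\<close> puts every eigenvalue in some
  Gershgorin disk.  Multiplicity one in the isolated disk needs neither a resolvent nor a homotopy.
  An eigenvector \<open>x\<close> for an eigenvalue in that disk has more than half of its mass in the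
  distinguished component \<open>O\<close>, because the other disks are further from \<open>z\<close> than \<open>z\<close> is from the
  boundary of its own.  A second eigenvector, or a generalized one, can be corrected by a multiple
  of \<open>x\<close> to some \<open>v\<close> vanishing on \<open>O\<close> with \<open>(z - D) v + \<delta> x = R v\<close>.  On \<open>O\<close> this equation makes \<open>R v\<close>
  absorb \<open>\<delta> x\<close> and off \<open>O\<close> it is only forced by the smaller rest of \<open>\<delta> x\<close>, so the column bound
  leaves only \<open>\<delta> = 0\<close> and \<open>v = 0\<close>.
\<close>


section \<open>Coordinates, norm and comparison of summable sequences\<close>

lemma fcoeff_zero [simp]: "fcoeff 0 i = 0"
  and fcoeff_add [simp]: "fcoeff (u + v) i = fcoeff u i + fcoeff v i"
  and fcoeff_diff [simp]: "fcoeff (u - v) i = fcoeff u i - fcoeff v i"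
  and fcoeff_scaleR [simp]: "fcoeff (r *\<^sub>R u) i = r *\<^sub>R fcoeff u i"
  and fcoeff_cscale [simp]: "fcoeff (c *\<^sub>C u) i = c * fcoeff u i"
  by (simp_all add: zero_ell1.rep_eq plus_ell1.rep_eq minus_ell1.rep_eq scaleR_ell1.rep_eq
      cscale.rep_eq)

lemma fcoeff_sum [simp]: "fcoeff (sum f F) i = (\<Sum>x\<in>F. fcoeff (f x) i)"
  by (induction F rule: infinite_finite_induct) simp_all

lemma norm_cscale: "norm (c *\<^sub>C u) = cmod c * norm u"
  by (simp add: norm_ell1_def norm_mult infsum_cmult_right')

lemma cmod_fcoeff_le_norm: "cmod (fcoeff u i) \<le> norm u"
  using finite_sum_le_infsum[OF fcoeff_summable, of "{i}" u] by (simp add: norm_ell1_def)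

lemma bounded_linear_fcoeff: "bounded_linear (\<lambda>u. fcoeff u i)"
  by (rule bounded_linear_intro[of _ 1]) (simp_all add: cmod_fcoeff_le_norm)

lemma norm_ell1_mono:
  assumes "\<And>i. cmod (fcoeff u i) \<le> cmod (fcoeff v i)"
  shows "norm u \<le> norm v"
  unfolding norm_ell1_def by (intro infsum_mono fcoeff_summable assms)

lemma summable_bounded_mult_fcoeff:
  assumes "\<And>i. cmod (c i) \<le> B"
  shows "(\<lambda>i. cmod (c i * fcoeff u i)) summable_on UNIV"
  by (rule Infinite_Sum.abs_summable_on_comparison_test'
        [OF summable_on_cmult_right[OF fcoeff_summable, of B u]])
     (simp add: norm_mult mult_right_mono assms)


lemma summable_diff:
  fixes f g :: "'i \<Rightarrow> real"
  assumes "f summable_on A" "g summable_on A"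
  shows "(\<lambda>i. f i - g i) summable_on A"
  using summable_on_add[OF assms(1) summable_on_uminus[THEN iffD2, OF assms(2)]] by simp

lemma infsum_minus_real:
  fixes f g :: "'i \<Rightarrow> real"
  assumes "f summable_on A" "g summable_on A"
  shows "(\<Sum>\<^sub>\<infinity>i\<in>A. f i - g i) = infsum f A - infsum g A"
  using infsum_add[OF assms(1) summable_on_uminus[THEN iffD2, OF assms(2)]] by (simp add: infsum_uminus)

section \<open>Isolated Gershgorin disks\<close>

text \<open>The remainder \<open>R\<close> enters only through its column bound. Bounded radii make
  the weighted sum converge for every sequence; for a non-summable family \<open>infsum\<close>
  would default to 0 and the bound would mean something else.\<close>

locale column_gershgorin =
  fixes V :: "'i ell1 set" and R :: "'i ell1 \<Rightarrow> 'i ell1"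
    and d :: "'i \<Rightarrow> complex" and \<rho> :: "'i \<Rightarrow> real"
  assumes radius_bounds: "\<And>i. 0 \<le> \<rho> i" "\<exists>B. \<forall>i. \<rho> i \<le> B"
    and column_bound: "\<And>v. v \<in> V \<Longrightarrow> norm (R v) \<le> (\<Sum>\<^sub>\<infinity>i. \<rho> i * cmod (fcoeff v i))"
begin

lemma radius_summable: "(\<lambda>i. \<rho> i * cmod (fcoeff v i)) summable_on UNIV"
proof -
  obtain B where "\<And>i. \<rho> i \<le> B" using radius_bounds(2) by blast
  then have "cmod (complex_of_real (\<rho> i)) \<le> B" for i using radius_bounds(1)[of i] by simp
  from summable_bounded_mult_fcoeff[of "\<lambda>i. complex_of_real (\<rho> i)", OF this, of v]
  show ?thesis using radius_bounds(1) by (simp add: norm_mult)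
qed

text \<open>Take absolute values in the equation and sum. On \<open>S\<close> the term with
  \<open>v\<close> drops out, so \<open>R v\<close> must spend mass there on
  \<open>\<delta> x\<close>, which is subtracted; off \<open>S\<close> the triangle inequality adds
  \<open>\<delta> x\<close>. This explains the signs in \<open>s\<close>; the column bound then
  absorbs \<open>norm (R v)\<close>.\<close>

lemma perturbed_eq_imp_gap:
  assumes v: "v \<in> V"
    and eq: "\<And>i. (z - d i) * fcoeff v i + \<delta> * fcoeff x i = fcoeff (R v) i"
    and vanish: "\<And>i. i \<in> S \<Longrightarrow> fcoeff v i = 0"
  defines "w \<equiv> \<lambda>i. (cmod (z - d i) - \<rho> i) * cmod (fcoeff v i)"
    and "s \<equiv> \<lambda>i. (if i \<in> S then - cmod (fcoeff x i) else cmod (fcoeff x i))"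
  shows "w summable_on UNIV" and "s summable_on UNIV"
    and "infsum w UNIV \<le> cmod \<delta> * infsum s UNIV"
proof -
  let ?a = "\<lambda>i. cmod ((z - d i) * fcoeff v i)"
  have s: "s summable_on UNIV"
    by (rule summable_on_iff_abs_summable_on_real[THEN iffD2])
       (rule Infinite_Sum.abs_summable_on_comparison_test'[OF fcoeff_summable[of x]], simp add: s_def)
  have rhs: "(\<lambda>i. cmod (fcoeff (R v) i) + cmod \<delta> * s i) summable_on UNIV"
    by (intro summable_on_add fcoeff_summable summable_on_cmult_right s)
  \<comment> \<open>On \<open>S\<close> both sides are 0, because \<open>\<delta> x\<close> and
    \<open>R v\<close> agree there.\<close>
  have le: "?a i \<le> cmod (fcoeff (R v) i) + cmod \<delta> * s i" for i
  proof (cases "i \<in> S")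
    case True
    then show ?thesis using eq[of i] vanish[of i] by (simp add: s_def norm_mult[symmetric])
  next
    case False
    have "(z - d i) * fcoeff v i = fcoeff (R v) i - \<delta> * fcoeff x i"
      using eq[of i] by (simp add: eq_diff_eq)
    then have "?a i = cmod (fcoeff (R v) i - \<delta> * fcoeff x i)" by simp
    also have "\<dots> \<le> cmod (fcoeff (R v) i) + cmod (\<delta> * fcoeff x i)" by (rule norm_triangle_ineq4)
    finally show ?thesis using False by (simp add: s_def norm_mult)
  qed
  \<comment> \<open>Summability of \<open>(z - d) v\<close> is not assumed but inherited from the
    right-hand side of the equation.\<close>
  have a: "?a summable_on UNIV"
    by (rule summable_on_comparison_test[OF rhs le]) simp
  have w_eq: "w = (\<lambda>i. ?a i - \<rho> i * cmod (fcoeff v i))"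
    by (simp add: w_def norm_mult left_diff_distrib[of "cmod _"])
  show "w summable_on UNIV"
    unfolding w_eq by (intro summable_diff a radius_summable)
  show "s summable_on UNIV" by (rule s)
  have "infsum ?a UNIV \<le> norm (R v) + cmod \<delta> * infsum s UNIV"
    using infsum_mono[OF a rhs le]
    by (simp add: norm_ell1_def infsum_add fcoeff_summable summable_on_cmult_right s
        infsum_cmult_right')
  moreover have "infsum w UNIV = infsum ?a UNIV - (\<Sum>\<^sub>\<infinity>i. \<rho> i * cmod (fcoeff v i))"
    unfolding w_eq by (rule infsum_minus_real[OF a radius_summable])
  ultimately show "infsum w UNIV \<le> cmod \<delta> * infsum s UNIV"
    using column_bound[OF v] by linarith
qed

text \<open>The left side of the gap inequality has nonnegative terms, while \<open>cone\<close>
  makes the right side negative unless \<open>\<delta> = 0\<close>. After that, all terms vanish,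
  and strict gaps give \<open>v = 0\<close>. Since \<open>cone\<close> is required only for
  \<open>\<delta> \<noteq> 0\<close>, the case without a source term is covered too.\<close>

lemma perturbed_eq_imp_trivial:
  assumes v: "v \<in> V"
    and eq: "\<And>i. (z - d i) * fcoeff v i + \<delta> * fcoeff x i = fcoeff (R v) i"
    and vanish: "\<And>i. i \<in> S \<Longrightarrow> fcoeff v i = 0"
    and gap: "\<And>i. i \<notin> S \<Longrightarrow> \<rho> i < cmod (z - d i)"
    and cone: "\<delta> \<noteq> 0 \<Longrightarrow> (\<Sum>\<^sub>\<infinity>i. if i \<in> S then - cmod (fcoeff x i) else cmod (fcoeff x i)) < 0"
  shows "\<delta> = 0" and "v = 0"
proof -
  note g = perturbed_eq_imp_gap[OF v eq vanish]
  have pos: "0 \<le> (cmod (z - d i) - \<rho> i) * cmod (fcoeff v i)" for i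
    using vanish[of i] gap[of i] by (cases "i \<in> S") auto
  show \<delta>: "\<delta> = 0"
  proof (rule ccontr)
    assume "\<delta> \<noteq> 0"
    with cone have "(\<Sum>\<^sub>\<infinity>i. (cmod (z - d i) - \<rho> i) * cmod (fcoeff v i)) < 0"
      by (intro le_less_trans[OF g(3)] mult_pos_neg) simp_all
    moreover have "0 \<le> (\<Sum>\<^sub>\<infinity>i. (cmod (z - d i) - \<rho> i) * cmod (fcoeff v i))"
      by (rule infsum_nonneg) (rule pos)
    ultimately show False by simp
  qed
  have "(cmod (z - d i) - \<rho> i) * cmod (fcoeff v i) = 0" for i
    using g(3) \<delta> by (intro nonneg_infsum_le_0D[OF _ g(1) pos]) auto
  then show "v = 0"
    using vanish gap by (intro ell1_eqI) force
qed

text \<open>Off the isolated disk, the distance of \<open>z\<close> to each disk exceeds its depth \<open>t\<close> inside the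
  isolated one, so an eigenvector has more mass on \<open>S\<close> than off it.\<close>

lemma eigenvector_mass:
  assumes v: "v \<in> V" "v \<noteq> 0"
    and eq: "\<And>i. (z - d i) * fcoeff v i = fcoeff (R v) i"
    and t: "0 \<le> t" "\<And>i. i \<in> S \<Longrightarrow> cmod (z - d i) - \<rho> i = - t"
      "\<And>i. i \<notin> S \<Longrightarrow> t < cmod (z - d i) - \<rho> i"
  shows "(\<Sum>\<^sub>\<infinity>i. if i \<in> S then - cmod (fcoeff v i) else cmod (fcoeff v i)) < 0"
proof -
  let ?s = "\<lambda>i. if i \<in> S then - cmod (fcoeff v i) else cmod (fcoeff v i)"
  let ?w = "\<lambda>i. (cmod (z - d i) - \<rho> i) * cmod (fcoeff v i)"
  \<comment> \<open>With \<open>S\<close> empty and \<open>\<delta> = 0\<close> the gap inequality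
    says that the weighted sum is at most 0.\<close>
  have w: "?w summable_on UNIV" "infsum ?w UNIV \<le> 0"
    using perturbed_eq_imp_gap[of v z 0 v "{}"] v eq by simp_all
  have s: "?s summable_on UNIV"
    by (rule summable_on_iff_abs_summable_on_real[THEN iffD2])
       (rule Infinite_Sum.abs_summable_on_comparison_test'[OF fcoeff_summable[of v]], simp)
  have ts: "(\<lambda>i. ?w i - t * ?s i) summable_on UNIV"
    by (intro summable_diff w summable_on_cmult_right s)
  have sum: "(\<Sum>\<^sub>\<infinity>i. ?w i - t * ?s i) = infsum ?w UNIV - t * infsum ?s UNIV"
    by (simp add: infsum_minus_real w summable_on_cmult_right s infsum_cmult_right')
  \<comment> \<open>On \<open>S\<close> the term is exactly 0, as the depth is the same
    \<open>t\<close> at all its indices.\<close>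
  have nn: "0 \<le> ?w i - t * ?s i" for i
    using t(2,3)[of i] by (cases "i \<in> S") (simp_all add: left_diff_distrib[symmetric])
  \<comment> \<open>If \<open>v\<close> lives on \<open>S\<close>, no strictly positive term is
    available, but the sum is then \<open>- norm v\<close>. Otherwise a single strict term decides,
    also for \<open>t = 0\<close>, where it contradicts \<open>w\<close>.\<close>
  show ?thesis
  proof (cases "\<forall>i. i \<notin> S \<longrightarrow> fcoeff v i = 0")
    case True
    then have "?s = (\<lambda>i. - cmod (fcoeff v i))" by auto
    then have "infsum ?s UNIV = - norm v" by (simp only: infsum_uminus norm_ell1_def)
    with v(2) show ?thesis by simp
  next
    case False
    then obtain i where i: "i \<notin> S" "fcoeff v i \<noteq> 0" by blast
    then have "(cmod (z - d i) - \<rho> i - t) * cmod (fcoeff v i) > 0" using t(3)[of i] by simp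
    then have "?w i - t * ?s i > 0" using i(1) by (simp add: left_diff_distrib)
    then have "0 < infsum ?w UNIV - t * infsum ?s UNIV"
      using nonneg_infsum_le_0D[OF _ ts nn UNIV_I, of i] infsum_nonneg[of UNIV "\<lambda>i. ?w i - t * ?s i", OF nn] sum
      by force
    with w(2) have "t * infsum ?s UNIV < 0" by linarith
    with t(1) show ?thesis by (simp add: mult_less_0_iff)
  qed
qed

end

section \<open>Expansion of symmetric sequences\<close>

lemma clinear_on_zero: "clinear_on X A \<Longrightarrow> 0 \<in> X \<Longrightarrow> A 0 = 0"
  unfolding clinear_on_def by (metis ell1.scale_zero_left)

lemma clinear_on_diff:
  assumes "clinear_on X A" "ell1.subspace X" "u \<in> X" "v \<in> X"
  shows "A (u - v) = A u - A v"
proof -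
  have "A ((u - v) + v) = A (u - v) + A v"
    using assms(1,4) ell1.subspace_diff[OF assms(2-4)] unfolding clinear_on_def by blast
  then show ?thesis by simp
qed

lemma clinear_on_sum_cscale:
  assumes "clinear_on X A" "ell1.subspace X" "\<And>i. i \<in> F \<Longrightarrow> f i \<in> X"
  shows "A (\<Sum>i\<in>F. c i *\<^sub>C f i) = (\<Sum>i\<in>F. c i *\<^sub>C A (f i))"
  using assms(3)
proof (induction F rule: infinite_finite_induct)
  case (insert i F)
  have "(\<Sum>i\<in>F. c i *\<^sub>C f i) \<in> X" "c i *\<^sub>C f i \<in> X"
    using insert.prems assms(2) by (auto intro!: ell1.subspace_sum ell1.subspace_scale)
  then show ?case
    using insert assms(1) by (simp add: clinear_on_def)
qed (use assms in \<open>auto simp: clinear_on_zero ell1.subspace_0\<close>)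

lemma clinear_onI:
  assumes "\<And>u v. u \<in> X \<Longrightarrow> v \<in> X \<Longrightarrow> A (u + v) = A u + A v"
    and "\<And>c u. u \<in> X \<Longrightarrow> A (c *\<^sub>C u) = c *\<^sub>C A u"
  shows "clinear_on X A"
  using assms by (simp add: clinear_on_def)

section \<open>Orbit representatives and reduced coordinates\<close>

locale symmetric_lattice =
  fixes G :: "('g, 'b) monoid_scheme" and \<phi> :: "'g \<Rightarrow> 'm::finite freq \<Rightarrow> 'm freq"
    and Z :: "'m freq set"
  assumes action: "linear_lattice_action G \<phi>"
    and reps: "orbit_representatives G \<phi> Z"
begin

sublocale group_action G UNIV \<phi>
  using action by (simp add: linear_lattice_action_def)

definition rep :: "'m freq \<Rightarrow> 'm freq" where
  "rep n = (THE r. r \<in> Z \<and> r \<in> orbit G \<phi> n)"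

lemma rep: "rep n \<in> Z" "rep n \<in> orbit G \<phi> n"
  using theI'[of "\<lambda>r. r \<in> Z \<and> r \<in> orbit G \<phi> n"] reps
  by (auto simp: orbit_representatives_def rep_def)

lemma rep_eqI: "r \<in> Z \<Longrightarrow> r \<in> orbit G \<phi> n \<Longrightarrow> rep n = r"
  using reps rep unfolding orbit_representatives_def by blast

text \<open>With this, questions about orbits and unfolded index sets become rewriting with
  \<open>rep\<close>.\<close>

lemma mem_orbit_iff: "k \<in> orbit G \<phi> n \<longleftrightarrow> rep k = rep n"
proof
  assume k: "k \<in> orbit G \<phi> n"
  then have "n \<in> orbit G \<phi> k" by (simp add: orbit_sym)
  then have "rep n \<in> orbit G \<phi> k" using orbit_trans[OF _ _ _ _ rep(2)] by simp
  then show "rep k = rep n" using rep(1) by (rule rep_eqI[rotated])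
next
  assume "rep k = rep n"
  then have "rep n \<in> orbit G \<phi> k" using rep(2)[of k] by simp
  then have "k \<in> orbit G \<phi> (rep n)" by (simp add: orbit_sym)
  then show "k \<in> orbit G \<phi> n" using orbit_trans[OF _ _ _ rep(2)] by simp
qed

lemma rep_action: "h \<in> carrier G \<Longrightarrow> rep (\<phi> h n) = rep n"
  unfolding mem_orbit_iff[symmetric] by (auto simp: orbit_def)

lemma rep_ident: "r \<in> Z \<Longrightarrow> rep r = r"
  by (rule rep_eqI) (simp_all add: mem_orbit_iff)

lemma rep_rep [simp]: "rep (rep n) = rep n"
  by (rule rep_ident) (rule rep)

lemma mem_unfold_iff: "S \<subseteq> Z \<Longrightarrow> n \<in> unfold_set G \<phi> S \<longleftrightarrow> rep n \<in> S"
  unfolding unfold_set_def mem_orbit_iff UN_iff by (metis rep_ident rep_rep subsetD)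

lemma finite_orbit: "finite (orbit G \<phi> n)"
  by (rule linear_lattice_action_orbit_finite[OF action])

lemma card_orbit_pos: "0 < card (orbit G \<phi> n)"
  using finite_orbit rep(2) by (auto simp: card_gt_0_iff)

lemma orbit_constant_iff: "orbit_constant G \<phi> a \<longleftrightarrow> (\<forall>n. a n = a (rep n))"
proof
  assume a: "orbit_constant G \<phi> a"
  show "\<forall>n. a n = a (rep n)"
  proof
    fix n
    obtain h where "h \<in> carrier G" "rep n = \<phi> h n" using rep(2)[of n] by (auto simp: orbit_def)
    then show "a n = a (rep n)" using a by (simp add: orbit_constant_def)
  qed
next
  assume "\<forall>n. a n = a (rep n)"
  then show "orbit_constant G \<phi> a"
    unfolding orbit_constant_def by (metis rep_action)
qed

lemma orbit_constant_rep: "orbit_constant G \<phi> a \<Longrightarrow> a (rep n) = a n"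
  unfolding orbit_constant_iff by metis

lemma sym_iff: "u \<in> sym_ell1 G \<phi> \<longleftrightarrow> (\<forall>j n. fcoeff u (j, n) = fcoeff u (j, rep n))"
  by (simp add: sym_ell1_def orbit_constant_iff)

lemma sym_rep: "u \<in> sym_ell1 G \<phi> \<Longrightarrow> fcoeff u (j, rep n) = fcoeff u (j, n)"
  unfolding sym_iff by metis

lemma subspace_sym: "ell1.subspace (sym_ell1 G \<phi>)"
  unfolding ell1.subspace_def by (simp add: sym_iff)

lemma proj_coeff:
  "S \<subseteq> Z \<Longrightarrow> fcoeff (proj G \<phi> S u) (j, n) = (if rep n \<in> S then fcoeff u (j, n) else 0)"
  by (simp add: fcoeff_proj mem_unfold_iff)

lemma orb_unit_coeff:
  "r \<in> Z \<Longrightarrow> fcoeff (orb_unit G \<phi> j r) (i, k) = (if i = j \<and> rep k = r then 1 else 0)"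
  by (simp add: fcoeff_orb_unit[OF action] mem_orbit_iff rep_ident)

lemma orb_unit_sym: "r \<in> Z \<Longrightarrow> orb_unit G \<phi> j r \<in> sym_ell1 G \<phi>"
  by (simp add: sym_iff orb_unit_coeff)

lemma proj_sym: "S \<subseteq> Z \<Longrightarrow> u \<in> sym_ell1 G \<phi> \<Longrightarrow> proj G \<phi> S u \<in> sym_ell1 G \<phi>"
  by (auto simp: sym_iff proj_coeff)

lemma proj_add: "proj G \<phi> S (u + v) = proj G \<phi> S u + proj G \<phi> S v"
  by (rule ell1_eqI) (auto simp: fcoeff_proj)

lemma proj_diff: "proj G \<phi> S (u - v) = proj G \<phi> S u - proj G \<phi> S v"
  by (rule ell1_eqI) (auto simp: fcoeff_proj)

lemma proj_cscale: "proj G \<phi> S (c *\<^sub>C u) = c *\<^sub>C proj G \<phi> S u"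
  by (rule ell1_eqI) (auto simp: fcoeff_proj)

lemma proj_compl: "S \<subseteq> Z \<Longrightarrow> proj G \<phi> (Z - S) u = u - proj G \<phi> S u"
  by (rule ell1_eqI) (auto simp: proj_coeff rep)

lemma proj_proj:
  "S \<subseteq> Z \<Longrightarrow> T \<subseteq> Z \<Longrightarrow> proj G \<phi> S (proj G \<phi> T u) = proj G \<phi> (S \<inter> T) u"
  by (rule ell1_eqI) (auto simp: proj_coeff le_infI1)

lemma norm_proj_le: "norm (proj G \<phi> S u) \<le> norm u"
  by (rule norm_ell1_mono) (auto simp: fcoeff_proj)

text \<open>The norm is additive over disjoint supports, so low and high parts can be estimated
  separately without loss.\<close>

lemma norm_proj_split:
  assumes "S \<subseteq> Z"
  shows "norm u = norm (proj G \<phi> S u) + norm (u - proj G \<phi> S u)"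
  unfolding norm_ell1_def infsum_add[OF fcoeff_summable fcoeff_summable, symmetric]
  by (intro infsum_cong) (auto simp: proj_coeff[OF assms])

text \<open>Passing from the lattice norm to finitely many representatives produces the orbit
  weights that appear in the radii.\<close>

lemma norm_proj_finite:
  fixes u :: "('p::finite \<times> 'm freq) ell1"
  assumes "S \<subseteq> Z" "finite S" "u \<in> sym_ell1 G \<phi>"
  shows "norm (proj G \<phi> S u) =
    (\<Sum>j\<in>UNIV. \<Sum>r\<in>S. real (card (orbit G \<phi> r)) * cmod (fcoeff u (j, r)))"
proof -
  have "(\<Sum>\<^sub>\<infinity>n\<in>Z. real (card (orbit G \<phi> n)) * cmod (fcoeff (proj G \<phi> S u) (j, n))) =
      (\<Sum>\<^sub>\<infinity>r\<in>S. real (card (orbit G \<phi> r)) * cmod (fcoeff u (j, r)))" for j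
    using assms(1) by (intro infsum_cong_neutral) (auto simp: proj_coeff rep_ident subset_iff)
  then show ?thesis
    using norm_sym_ell1[OF action reps proj_sym[OF assms(1,3)]] assms(2) by simp
qed

lemma norm_orb_unit:
  assumes "r \<in> Z"
  shows "norm (orb_unit G \<phi> (j::'p::finite) r) = real (card (orbit G \<phi> r))"
proof -
  have eq: "proj G \<phi> {r} (orb_unit G \<phi> j r) = orb_unit G \<phi> j r"
    using assms by (intro ell1_eqI) (auto simp: proj_coeff orb_unit_coeff)
  have "norm (orb_unit G \<phi> j r) =
      (\<Sum>i\<in>UNIV. real (card (orbit G \<phi> r)) * cmod (fcoeff (orb_unit G \<phi> j r) (i, r)))"
    unfolding eq[symmetric, THEN arg_cong[where f = norm]]
    using norm_proj_finite[of "{r}", OF _ _ orb_unit_sym[OF assms, of j]] assms by simp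
  also have "\<dots> = (\<Sum>i\<in>UNIV. if i = j then real (card (orbit G \<phi> r)) else 0)"
    using assms by (intro sum.cong) (auto simp: orb_unit_coeff rep_ident)
  finally show ?thesis by simp
qed

lemma proj_expand:
  fixes u :: "('p::finite \<times> 'm freq) ell1"
  assumes "S \<subseteq> Z" "finite S" "u \<in> sym_ell1 G \<phi>"
  shows "proj G \<phi> S u = (\<Sum>x\<in>UNIV \<times> S. fcoeff u x *\<^sub>C orb_unit G \<phi> (fst x) (snd x))"
proof (rule ell1_eqI, clarify)
  fix j n
  \<comment> \<open>The unit of \<open>x\<close> is nonzero at \<open>(j, n)\<close> only for
    \<open>x = (j, rep n)\<close>.\<close>
  have "(\<Sum>x\<in>UNIV \<times> S. fcoeff u x * fcoeff (orb_unit G \<phi> (fst x) (snd x)) (j, n)) =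
      (\<Sum>x\<in>UNIV \<times> S. if x = (j, rep n) then fcoeff u x else 0)"
    using assms(1) by (intro sum.cong) (auto simp: orb_unit_coeff subset_iff split: if_splits)
  also have "\<dots> = fcoeff (proj G \<phi> S u) (j, n)"
    using assms by (simp add: sum.delta proj_coeff sym_rep)
  finally show "fcoeff (proj G \<phi> S u) (j, n) =
      fcoeff (\<Sum>x\<in>UNIV \<times> S. fcoeff u x *\<^sub>C orb_unit G \<phi> (fst x) (snd x)) (j, n)" by simp
qed

text \<open>Sharper than \<open>cmod_fcoeff_le_norm\<close> by the orbit weight, because the
  coefficient is repeated along the whole orbit. The same weight is the norm of a unit, so it
  cancels when operators are tested on units.\<close>

lemma orb_unit_sum_coeff_le:
  fixes u :: "('p::finite \<times> 'm freq) ell1"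
  assumes "u \<in> sym_ell1 G \<phi>" "r \<in> Z"
  shows "cmod (fcoeff u (j, r)) * real (card (orbit G \<phi> r)) \<le> norm u"
proof -
  have "real (card (orbit G \<phi> r)) * cmod (fcoeff u (j, r)) \<le>
      (\<Sum>i\<in>UNIV. real (card (orbit G \<phi> r)) * cmod (fcoeff u (i, r)))"
    by (rule member_le_sum) simp_all
  also have "\<dots> = norm (proj G \<phi> {r} u)"
    using norm_proj_finite[of "{r}" u] assms by simp
  also have "\<dots> \<le> norm u" by (rule norm_proj_le)
  finally show ?thesis by (simp add: mult.commute)
qed

lemma small_tail:
  fixes u :: "('p::finite \<times> 'm freq) ell1"
  assumes u: "u \<in> sym_ell1 G \<phi>" and S0: "S0 \<subseteq> Z" "finite S0" and e: "0 < e"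
  obtains S where "S0 \<subseteq> S" "S \<subseteq> Z" "finite S" "norm (u - proj G \<phi> S u) \<le> e"
proof -
  obtain F where F: "finite F" "dist (\<Sum>i\<in>F. cmod (fcoeff u i)) (norm u) \<le> e"
    using infsum_finite_approximation[OF fcoeff_summable e, of u] by (auto simp: norm_ell1_def)
  \<comment> \<open>Replacing the frequencies in \<open>F\<close> by their representatives gives a
    set whose projection keeps all coefficients on \<open>F\<close>.\<close>
  define S where "S = S0 \<union> rep ` snd ` F"
  have S: "S0 \<subseteq> S" "S \<subseteq> Z" "finite S" using S0 F(1) rep by (auto simp: S_def)
  have "fcoeff (proj G \<phi> S u) i = fcoeff u i" if "i \<in> F" for i
    using that S by (cases i) (force simp: proj_coeff S_def)
  then have "(\<Sum>i\<in>F. cmod (fcoeff u i)) = (\<Sum>i\<in>F. cmod (fcoeff (proj G \<phi> S u) i))" by simp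
  also have "\<dots> \<le> norm (proj G \<phi> S u)"
    unfolding norm_ell1_def by (rule finite_sum_le_infsum[OF fcoeff_summable F(1)]) auto
  finally have "norm (u - proj G \<phi> S u) \<le> e"
    using norm_proj_split[OF S(2), of u] F(2) by (simp add: dist_real_def)
  with S show thesis by (rule that)
qed

text \<open>Extends column bounds from units to all of \<open>D\<close>. The finite part of
  \<open>v\<close> is a combination of units; the tail is small, and \<open>T\<close> is bounded on
  it by \<open>high\<close>. Continuity is thus used only on sequences that vanish on
  \<open>S0\<close>.\<close>

lemma norm_le_weighted_columns:
  fixes T :: "('p::finite \<times> 'm freq) ell1 \<Rightarrow> ('p \<times> 'm freq) ell1"
  assumes D: "ell1.subspace D" "D \<subseteq> sym_ell1 G \<phi>" "\<And>j r. r \<in> Z \<Longrightarrow> orb_unit G \<phi> j r \<in> D"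
    and T: "clinear_on D T"
    and S0: "S0 \<subseteq> Z" "finite S0"
    and high: "\<And>u. u \<in> D \<Longrightarrow> proj G \<phi> S0 u = 0 \<Longrightarrow> norm (T u) \<le> C * norm u"
    and col: "\<And>j r. r \<in> Z \<Longrightarrow> norm (T (orb_unit G \<phi> j r)) \<le> c j r * real (card (orbit G \<phi> r))"
    and c: "\<And>j r. 0 \<le> c j r" "\<And>j r. c j r \<le> B"
    and v: "v \<in> D"
  shows "norm (T v) \<le> (\<Sum>\<^sub>\<infinity>x. c (fst x) (rep (snd x)) * cmod (fcoeff v x))" (is "_ \<le> ?I")
proof (rule field_le_epsilon)
  fix e :: real assume e: "0 < e"
  let ?L = "\<lambda>j n. complex_of_real (c j (rep n))"
  \<comment> \<open>Multiplying \<open>v\<close> by the column bounds gives a symmetric sequence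
    whose norm is the right-hand side, so finite weighted sums become norms of its
    projections.\<close>
  define w where "w = diag_op ?L v"
  have v': "v \<in> sym_ell1 G \<phi>" using v D(2) by blast
  have "(\<lambda>x. cmod (?L (fst x) (snd x) * fcoeff v x)) summable_on UNIV"
    by (rule summable_bounded_mult_fcoeff[where B = B]) (simp add: c)
  then have dom: "v \<in> diag_dom (sym_ell1 G \<phi>) ?L"
    using v' by (simp add: diag_dom_def case_prod_unfold)
  have w: "fcoeff w (j, n) = ?L j n * fcoeff v (j, n)" for j n
    unfolding w_def by (rule fcoeff_diag_op[OF dom])
  have w_sym: "w \<in> sym_ell1 G \<phi>" using v' by (auto simp: sym_iff w)
  have w_norm: "norm w = ?I"
    unfolding norm_ell1_def by (rule infsum_cong) (auto simp: w norm_mult c)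
  \<comment> \<open>A positive substitute for \<open>C\<close>, by which \<open>e\<close> can be
    divided.\<close>
  define C' where "C' = \<bar>C\<bar> + 1"
  have C': "C' > 0" by (simp add: C'_def)
  obtain S where S: "S0 \<subseteq> S" "S \<subseteq> Z" "finite S" "norm (v - proj G \<phi> S v) \<le> e / C'"
    using small_tail[OF v' S0, of "e / C'"] e C' by auto
  let ?v = "proj G \<phi> S v"
  have vS: "?v = (\<Sum>x\<in>UNIV \<times> S. fcoeff v x *\<^sub>C orb_unit G \<phi> (fst x) (snd x))"
    by (rule proj_expand[OF S(2,3) v'])
  have unit: "orb_unit G \<phi> (fst x) (snd x) \<in> D" if "x \<in> UNIV \<times> S" for x
    using that S(2) D(3) by auto
  have vD: "?v \<in> D"
    unfolding vS using unit D(1) by (auto intro!: ell1.subspace_sum ell1.subspace_scale)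
  \<comment> \<open>Since \<open>S\<close> contains \<open>S0\<close>, the tail satisfies the
    premise of \<open>high\<close>.\<close>
  have "proj G \<phi> S0 (v - ?v) = 0"
    using S by (intro ell1_eqI) (auto simp: proj_diff proj_coeff S0)
  then have "norm (T (v - ?v)) \<le> C * norm (v - ?v)"
    using high v vD D(1) by (auto simp: ell1.subspace_diff)
  also have "\<dots> \<le> C' * norm (v - ?v)" by (rule mult_right_mono) (auto simp: C'_def)
  also have "\<dots> \<le> e" using S(4) C' by (simp add: field_simps)
  finally have tail: "norm (T (v - ?v)) \<le> e" .
  have "T ?v = (\<Sum>x\<in>UNIV \<times> S. fcoeff v x *\<^sub>C T (orb_unit G \<phi> (fst x) (snd x)))"
    unfolding vS by (rule clinear_on_sum_cscale[OF T D(1) unit])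
  also have "norm \<dots> \<le> (\<Sum>x\<in>UNIV \<times> S. cmod (fcoeff v x) * (c (fst x) (snd x) * real (card (orbit G \<phi> (snd x)))))"
    using S(2) col by (intro sum_norm_le) (auto simp: norm_cscale intro!: mult_left_mono)
  also have "\<dots> = norm (proj G \<phi> S w)"
    unfolding norm_proj_finite[OF S(2,3) w_sym] sum.cartesian_product
    using S(2) by (intro sum.cong) (auto simp: w norm_mult c rep_ident subset_iff)
  also have "\<dots> \<le> ?I" using norm_proj_le[of S w] w_norm by simp
  finally have "norm (T ?v) \<le> ?I" .
  moreover have "T v = T ?v + T (v - ?v)"
    using clinear_on_diff[OF T D(1) v vD] by simp
  ultimately show "norm (T v) \<le> ?I + e"
    using tail norm_triangle_ineq[of "T ?v" "T (v - ?v)"] by simp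
qed

end

section \<open>Diagonal operators and convolutions\<close>

context symmetric_lattice
begin

lemma diag_dom_iff:
  "v \<in> diag_dom X L \<longleftrightarrow> v \<in> X \<and> (\<lambda>x. cmod (L (fst x) (snd x) * fcoeff v x)) summable_on UNIV"
  by (simp add: diag_dom_def case_prod_unfold)

text \<open>A bounded change of symbol alters the image by a summable sequence only, so it cannot
  shrink the domain.\<close>

lemma diag_dom_mono:
  assumes "\<And>j n. cmod (L' j n - L j n) \<le> K"
  shows "diag_dom X L \<subseteq> diag_dom X L'"
proof
  fix v assume v: "v \<in> diag_dom X L"
  have "(\<lambda>x. cmod (L (fst x) (snd x) * fcoeff v x) + K * cmod (fcoeff v x)) summable_on UNIV"
    using v by (intro summable_on_add summable_on_cmult_right fcoeff_summable) (simp add: diag_dom_iff)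
  moreover have "cmod (L' (fst x) (snd x) * fcoeff v x) \<le>
      cmod (L (fst x) (snd x) * fcoeff v x) + K * cmod (fcoeff v x)" for x
  proof -
    have "L' (fst x) (snd x) * fcoeff v x = L (fst x) (snd x) * fcoeff v x +
        (L' (fst x) (snd x) - L (fst x) (snd x)) * fcoeff v x" by (simp add: algebra_simps)
    also have "cmod \<dots> \<le> cmod (L (fst x) (snd x) * fcoeff v x) +
        cmod ((L' (fst x) (snd x) - L (fst x) (snd x)) * fcoeff v x)" by (rule norm_triangle_ineq)
    finally show ?thesis
      using mult_right_mono[OF assms, of "cmod (fcoeff v x)" "fst x" "snd x"] by (simp add: norm_mult)
  qed
  ultimately have "(\<lambda>x. cmod (L' (fst x) (snd x) * fcoeff v x)) summable_on UNIV"
    by (rule Infinite_Sum.abs_summable_on_comparison_test')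
  with v show "v \<in> diag_dom X L'" by (simp add: diag_dom_iff)
qed

lemma subspace_diag_dom:
  assumes "ell1.subspace X"
  shows "ell1.subspace (diag_dom X L)"
  unfolding ell1.subspace_def
proof (intro conjI ballI allI)
  show "0 \<in> diag_dom X L" using assms by (simp add: diag_dom_iff ell1.subspace_0)
next
  fix u v assume uv: "u \<in> diag_dom X L" "v \<in> diag_dom X L"
  have "(\<lambda>x. cmod (L (fst x) (snd x) * fcoeff u x) + cmod (L (fst x) (snd x) * fcoeff v x)) summable_on UNIV"
    using uv by (intro summable_on_add) (simp_all add: diag_dom_iff)
  then have "(\<lambda>x. cmod (L (fst x) (snd x) * fcoeff (u + v) x)) summable_on UNIV"
    by (rule Infinite_Sum.abs_summable_on_comparison_test') (simp add: distrib_left norm_triangle_ineq)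
  then show "u + v \<in> diag_dom X L" using uv assms by (simp add: diag_dom_iff ell1.subspace_add)
next
  fix c v assume v: "v \<in> diag_dom X L"
  have "(\<lambda>x. cmod c * cmod (L (fst x) (snd x) * fcoeff v x)) summable_on UNIV"
    using v by (intro summable_on_cmult_right) (simp add: diag_dom_iff)
  then have "(\<lambda>x. cmod (L (fst x) (snd x) * fcoeff (c *\<^sub>C v) x)) summable_on UNIV"
    by (simp add: norm_mult mult_ac)
  then show "c *\<^sub>C v \<in> diag_dom X L" using v assms by (simp add: diag_dom_iff ell1.subspace_scale)
qed

lemma orb_unit_diag_dom:
  assumes "r \<in> Z"
  shows "orb_unit G \<phi> j r \<in> diag_dom (sym_ell1 G \<phi>) L"
proof -
  let ?u = "orb_unit G \<phi> j r"
  have "(\<lambda>x. cmod (L (fst x) (snd x) * fcoeff ?u x)) summable_on {j} \<times> orbit G \<phi> r"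
    by (rule summable_on_finite) (simp add: finite_orbit)
  then have "(\<lambda>x. cmod (L (fst x) (snd x) * fcoeff ?u x)) summable_on UNIV"
    by (rule summable_on_cong_neutral[THEN iffD1, rotated -1])
       (auto simp: fcoeff_orb_unit[OF action] split: if_splits)
  then show ?thesis using assms by (simp add: diag_dom_iff orb_unit_sym)
qed

lemma finite_support_diag_dom:
  fixes u :: "('p::finite \<times> 'm freq) ell1"
  assumes "u \<in> sym_ell1 G \<phi>" "S \<subseteq> Z" "finite S"
  shows "proj G \<phi> S u \<in> diag_dom (sym_ell1 G \<phi>) L"
  unfolding proj_expand[OF assms(2,3,1)]
  using assms(2) by (auto intro!: ell1.subspace_sum ell1.subspace_scale subspace_diag_dom
      subspace_sym orb_unit_diag_dom)

lemma clinear_on_diag_op: 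
  assumes "ell1.subspace X"
  shows "clinear_on (diag_dom X L) (diag_op L)"
proof (rule clinear_onI)
  note sub = subspace_diag_dom[OF assms, of L]
  fix u assume u: "u \<in> diag_dom X L"
  show "diag_op L (c *\<^sub>C u) = c *\<^sub>C diag_op L u" for c
    by (intro ell1_eqI)
       (auto simp: fcoeff_diag_op[OF u] fcoeff_diag_op[OF ell1.subspace_scale[OF sub u]])
  show "diag_op L (u + v) = diag_op L u + diag_op L v" if v: "v \<in> diag_dom X L" for v
    by (intro ell1_eqI)
       (auto simp: fcoeff_diag_op[OF u] fcoeff_diag_op[OF v]
          fcoeff_diag_op[OF ell1.subspace_add[OF sub u v]] algebra_simps)
qed

lemma diag_op_sym:
  assumes "\<And>j. orbit_constant G \<phi> (L j)" "v \<in> diag_dom (sym_ell1 G \<phi>) L"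
  shows "diag_op L v \<in> sym_ell1 G \<phi>"
proof -
  have "v \<in> sym_ell1 G \<phi>" using assms(2) by (simp add: diag_dom_iff)
  then show ?thesis
    by (simp add: sym_iff fcoeff_diag_op[OF assms(2)] orbit_constant_rep[OF assms(1)] sym_rep)
qed

end

section \<open>Convolution blocks and their columns\<close>

lemma norm_ell1_components:
  fixes u :: "('p::finite \<times> 'n) ell1"
  shows "norm u = (\<Sum>j\<in>UNIV. \<Sum>\<^sub>\<infinity>n. cmod (fcoeff u (j, n)))"
proof -
  have "(\<lambda>(j, n). cmod (fcoeff u (j, n))) summable_on UNIV \<times> UNIV"
    using fcoeff_summable[of u] by (simp add: case_prod_unfold)
  from infsum_Sigma'_banach[OF this] show ?thesis
    by (simp add: norm_ell1_def case_prod_unfold)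
qed

text \<open>Collects the translates by \<open>n\<close> of all kernels in column \<open>j\<close>
  into one element of the tuple space; translation preserves the norm.\<close>

lemma column_shift:
  fixes q :: "'p::finite \<Rightarrow> 'p \<Rightarrow> 'm::finite freq ell1"
  obtains w :: "('p \<times> 'm freq) ell1"
  where "\<And>i k. fcoeff w (i, k) = fcoeff (q i j) (k - n)" "norm w = col_norm q j"
proof -
  let ?f = "\<lambda>(i, k). fcoeff (q i j) (k - n)"
  have bij: "bij_betw (\<lambda>k::'m freq. k - n) UNIV UNIV"
    by (rule bij_betwI[where g = "\<lambda>k. k + n"]) auto
  have s: "(\<lambda>k. cmod (fcoeff (q i j) (k - n))) summable_on UNIV" for i
    using summable_on_reindex_bij_betw[OF bij, of "\<lambda>k. cmod (fcoeff (q i j) k)"] fcoeff_summable by simp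
  have "(\<lambda>x. cmod (?f x)) summable_on (SIGMA i:(UNIV::'p set). (UNIV::'m freq set))"
    by (rule summable_on_SigmaI[where g = "\<lambda>i. \<Sum>\<^sub>\<infinity>k. cmod (fcoeff (q i j) (k - n))"])
       (use s in auto)
  then have "(\<lambda>x. cmod (?f x)) summable_on UNIV" by simp
  then have w: "fcoeff (Abs_ell1 ?f) (i, k) = fcoeff (q i j) (k - n)" for i k
    by (simp add: Abs_ell1_inverse)
  have "(\<Sum>\<^sub>\<infinity>k. cmod (fcoeff (q i j) (k - n))) = norm (q i j)" for i
    using infsum_reindex_bij_betw[OF bij, of "\<lambda>k. cmod (fcoeff (q i j) k)"] by (simp add: norm_ell1_def)
  then have "norm (Abs_ell1 ?f) = col_norm q j"
    by (simp add: norm_ell1_components w col_norm_def)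
  with w show thesis by (rule that)
qed

locale block_convolution = symmetric_lattice G \<phi> Z
  for G :: "('g, 'b) monoid_scheme" and \<phi> :: "'g \<Rightarrow> 'm::finite freq \<Rightarrow> 'm freq" and Z +
  fixes N :: nat and q :: "'p::finite \<Rightarrow> 'p \<Rightarrow> 'm freq ell1"
    and B :: "('p \<times> 'm freq) ell1 \<Rightarrow> ('p \<times> 'm freq) ell1"
  assumes compatible: "cutoff_compatible G \<phi> Z N"
    and q_sym: "\<And>i j. orbit_constant G \<phi> (fcoeff (q i j))"
    and q_supp: "\<And>i j n. n \<in> Z - idx Z (2 * N) \<Longrightarrow> fcoeff (q i j) n = 0"
    and linear: "clinear_on (sym_ell1 G \<phi>) B"
    and blocks: "\<And>v i k. v \<in> sym_ell1 G \<phi> \<Longrightarrow>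
       fcoeff (B v) (i, k) = (\<Sum>j\<in>UNIV. conv (fcoeff (q i j)) (\<lambda>n. fcoeff v (j, n)) k)"
begin

lemma idx_subset: "idx Z K \<subseteq> Z"
  by (auto simp: idx_def)

lemma column_coeff:
  assumes "r \<in> Z"
  shows "fcoeff (B (orb_unit G \<phi> j r)) (i, k) = (\<Sum>n\<in>orbit G \<phi> r. fcoeff (q i j) (k - n))"
proof -
  have "conv (fcoeff (q i j')) (\<lambda>n. fcoeff (orb_unit G \<phi> j r) (j', n)) k =
      (if j' = j then \<Sum>n\<in>orbit G \<phi> r. fcoeff (q i j) (k - n) else 0)" for j'
  proof (cases "j' = j")
    case True
    have "conv (fcoeff (q i j)) (\<lambda>n. fcoeff (orb_unit G \<phi> j r) (j, n)) k =
        infsum (\<lambda>n. fcoeff (q i j) (k - n)) (orbit G \<phi> r)"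
      unfolding conv_def
      by (rule infsum_cong_neutral) (auto simp: fcoeff_orb_unit[OF action])
    then show ?thesis using True by (simp add: finite_orbit)
  qed (simp add: conv_def fcoeff_orb_unit[OF action])
  then show ?thesis using blocks[OF orb_unit_sym[OF assms]] by simp
qed

text \<open>A unit is the indicator of an orbit, so its image is a sum of as many translated kernel
  columns as the orbit has points.\<close>

lemma column_norm:
  assumes "r \<in> Z"
  shows "norm (B (orb_unit G \<phi> j r)) \<le> col_norm q j * real (card (orbit G \<phi> r))"
proof -
  have "\<exists>w :: ('p \<times> 'm freq) ell1. (\<forall>i k. fcoeff w (i, k) = fcoeff (q i j) (k - n)) \<and> norm w = col_norm q j" for n
    using column_shift[of q j n] by metis
  then obtain w :: "'m freq \<Rightarrow> ('p \<times> 'm freq) ell1" where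
    w: "\<And>n i k. fcoeff (w n) (i, k) = fcoeff (q i j) (k - n)" "\<And>n. norm (w n) = col_norm q j"
    by metis
  have "B (orb_unit G \<phi> j r) = (\<Sum>n\<in>orbit G \<phi> r. w n)"
    by (rule ell1_eqI) (auto simp: column_coeff[OF assms] w)
  then show ?thesis
    using norm_sum[of w "orbit G \<phi> r"] by (simp add: w mult.commute)
qed

text \<open>The support condition speaks of representatives only; constancy on orbits carries it to
  the whole lattice.\<close>

lemma q_eq_0:
  assumes "n \<notin> unfold_set G \<phi> (idx Z (2 * N))"
  shows "fcoeff (q i j) n = 0"
proof -
  have "fcoeff (q i j) n = fcoeff (q i j) (rep n)" by (rule orbit_constant_rep[OF q_sym, symmetric])
  with q_supp[of "rep n"] assms rep(1) show ?thesis by (simp add: mem_unfold_iff[OF idx_subset])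
qed

text \<open>Write \<open>k = n + (k - n)\<close>: a low index plus an index in the kernel support
  lands in the \<open>3 * N\<close> range by compatibility.\<close>

lemma column_support_low:
  assumes r: "r \<in> idx Z N" and k: "rep k \<notin> idx Z (3 * N)"
  shows "fcoeff (B (orb_unit G \<phi> j r)) (i, k) = 0"
proof -
  have rZ: "r \<in> Z" using r idx_subset by blast
  have "fcoeff (q i j) (k - n) = 0" if n: "n \<in> orbit G \<phi> r" for n
  proof (rule q_eq_0, rule notI)
    assume "k - n \<in> unfold_set G \<phi> (idx Z (2 * N))"
    moreover have "n \<in> unfold_set G \<phi> (idx Z N)" using n r by (auto simp: unfold_set_def)
    ultimately have "n + (k - n) \<in> unfold_set G \<phi> (idx Z (3 * N))"
      using compatible unfolding cutoff_compatible_def by blast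
    with k show False by (simp add: mem_unfold_iff[OF idx_subset])
  qed
  then show ?thesis by (simp add: column_coeff[OF rZ])
qed

text \<open>Here the source is recovered as \<open>n = k - (k - n)\<close>, which is why
  compatibility also covers differences.\<close>

lemma column_support_high:
  assumes r: "r \<in> Z" "r \<notin> idx Z (3 * N)" and k: "rep k \<in> idx Z N"
  shows "fcoeff (B (orb_unit G \<phi> j r)) (i, k) = 0"
proof -
  have "fcoeff (q i j) (k - n) = 0" if n: "n \<in> orbit G \<phi> r" for n
  proof (rule q_eq_0, rule notI)
    assume "k - n \<in> unfold_set G \<phi> (idx Z (2 * N))"
    moreover have "k \<in> unfold_set G \<phi> (idx Z N)" using k by (simp add: mem_unfold_iff[OF idx_subset])
    ultimately have "k - (k - n) \<in> unfold_set G \<phi> (idx Z (3 * N))"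
      using compatible unfolding cutoff_compatible_def by blast
    then have "rep n \<in> idx Z (3 * N)" by (simp add: mem_unfold_iff[OF idx_subset])
    with n r show False by (simp add: mem_orbit_iff rep_ident)
  qed
  then show ?thesis by (simp add: column_coeff[OF r(1)])
qed

lemma low_support:
  assumes u: "u \<in> sym_ell1 G \<phi>" "proj G \<phi> (idx Z N) u = u" and k: "rep k \<notin> idx Z (3 * N)"
  shows "fcoeff (B u) (i, k) = 0"
proof -
  have "B u = B (\<Sum>x\<in>UNIV \<times> idx Z N. fcoeff u x *\<^sub>C orb_unit G \<phi> (fst x) (snd x))"
    using proj_expand[OF idx_subset finite_idx u(1)] u(2) by simp
  also have "\<dots> = (\<Sum>x\<in>UNIV \<times> idx Z N. fcoeff u x *\<^sub>C B (orb_unit G \<phi> (fst x) (snd x)))"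
    by (intro clinear_on_sum_cscale[OF linear subspace_sym] orb_unit_sym)
       (auto dest: subsetD[OF idx_subset])
  finally show ?thesis using k by (auto simp: column_support_low intro!: sum.neutral)
qed

end


section \<open>Finite blocks\<close>

locale low_block = symmetric_lattice G \<phi> Z
  for G :: "('g, 'b) monoid_scheme" and \<phi> :: "'g \<Rightarrow> 'm::finite freq \<Rightarrow> 'm freq" and Z +
  fixes N :: nat and B :: "('p::finite \<times> 'm freq) ell1 \<Rightarrow> ('p \<times> 'm freq) ell1"
  assumes block: "finite_block (sym_ell1 G \<phi>) (proj G \<phi> (idx Z N)) B"
begin

lemma low_subset: "idx Z N \<subseteq> Z"
  by (auto simp: idx_def)

lemma block_linear: "clinear_on (sym_ell1 G \<phi>) B"
  and block_sym: "u \<in> sym_ell1 G \<phi> \<Longrightarrow> B u \<in> sym_ell1 G \<phi>"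
  and block_proj: "u \<in> sym_ell1 G \<phi> \<Longrightarrow> B u = proj G \<phi> (idx Z N) (B (proj G \<phi> (idx Z N) u))"
  using block by (auto simp: finite_block_def)

lemma proj_low_idem: "proj G \<phi> (idx Z N) (proj G \<phi> (idx Z N) u) = proj G \<phi> (idx Z N) u"
  using proj_proj[OF low_subset low_subset] by simp

lemma proj_block: "u \<in> sym_ell1 G \<phi> \<Longrightarrow> proj G \<phi> (idx Z N) (B u) = B u"
  by (metis block_proj proj_low_idem)

lemma block_of_proj: "u \<in> sym_ell1 G \<phi> \<Longrightarrow> B (proj G \<phi> (idx Z N) u) = B u"
  by (metis block_proj proj_low_idem proj_sym[OF low_subset])

lemma block_zero: "B 0 = 0"
  by (rule clinear_on_zero[OF block_linear]) (rule ell1.subspace_0[OF subspace_sym])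

text \<open>Finitely many units determine the block, and each coefficient is at most the norm. A
  bound is needed first because the real supremum in \<open>onorm_on\<close> has meaning only for a
  bounded set of quotients.\<close>

lemma block_bound: "\<exists>C. \<forall>u\<in>sym_ell1 G \<phi>. norm (B u) \<le> C * norm u"
proof (intro exI ballI)
  fix u :: "('p \<times> 'm freq) ell1" assume u: "u \<in> sym_ell1 G \<phi>"
  let ?e = "\<lambda>x :: 'p \<times> 'm freq. orb_unit G \<phi> (fst x) (snd x)"
  have "B u = B (\<Sum>x\<in>UNIV \<times> idx Z N. fcoeff u x *\<^sub>C ?e x)"
    using proj_expand[OF low_subset finite_idx u] block_of_proj[OF u] by simp
  also have "\<dots> = (\<Sum>x\<in>UNIV \<times> idx Z N. fcoeff u x *\<^sub>C B (?e x))"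
    using low_subset by (intro clinear_on_sum_cscale[OF block_linear subspace_sym] orb_unit_sym) auto
  also have "norm \<dots> \<le> (\<Sum>x\<in>UNIV \<times> idx Z N. norm u * norm (B (?e x)))"
    by (intro sum_norm_le) (auto simp: norm_cscale intro!: mult_right_mono cmod_fcoeff_le_norm)
  finally show "norm (B u) \<le> (\<Sum>x\<in>UNIV \<times> idx Z N. norm (B (?e x))) * norm u"
    by (simp add: sum_distrib_left mult.commute)
qed

lemma block_onorm:
  assumes u: "u \<in> sym_ell1 G \<phi>"
  shows "norm (B u) \<le> onorm_on (sym_ell1 G \<phi>) B * norm u"
proof (cases "u = 0")
  case False
  obtain C where C: "\<And>u. u \<in> sym_ell1 G \<phi> \<Longrightarrow> norm (B u) \<le> C * norm u"
    using block_bound by blast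
  have "bdd_above ((\<lambda>u. norm (B u) / norm u) ` sym_ell1 G \<phi>)"
  proof (rule bdd_aboveI2)
    fix v :: "('p \<times> 'm freq) ell1" assume "v \<in> sym_ell1 G \<phi>"
    \<comment> \<open>The maximum with 0 covers \<open>v = 0\<close>, where the quotient is 0 by the
      convention for division by zero.\<close>
    then show "norm (B v) / norm v \<le> max C 0"
      using C[of v] by (cases "v = 0") (auto simp: divide_simps le_max_iff_disj)
  qed
  then have "norm (B u) / norm u \<le> onorm_on (sym_ell1 G \<phi>) B"
    unfolding onorm_on_def by (rule cSUP_upper[OF u])
  with False show ?thesis by (simp add: divide_simps)
qed (simp add: block_zero)

abbreviation "ext \<equiv> extend_block G \<phi> Z N B"

lemma ext_alt: "ext u = B u + (u - proj G \<phi> (idx Z N) u)"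
  by (simp add: extend_block_def proj_compl[OF low_subset])

lemma ext_sym: "u \<in> sym_ell1 G \<phi> \<Longrightarrow> ext u \<in> sym_ell1 G \<phi>"
  unfolding ext_alt
  by (intro ell1.subspace_add ell1.subspace_diff subspace_sym block_sym proj_sym low_subset)

lemma ext_linear: "clinear_on (sym_ell1 G \<phi>) ext"
  using block_linear unfolding ext_alt clinear_on_def
  by (auto simp: proj_add proj_cscale ell1.scale_right_distrib ell1.scale_right_diff_distrib)

lemma ext_low: "u \<in> sym_ell1 G \<phi> \<Longrightarrow> proj G \<phi> (idx Z N) (ext u) = B u"
  by (simp add: ext_alt proj_add proj_diff proj_low_idem proj_block)

lemma ext_high: "u \<in> sym_ell1 G \<phi> \<Longrightarrow> ext u - proj G \<phi> (idx Z N) (ext u) = u - proj G \<phi> (idx Z N) u"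
  unfolding ext_low by (simp add: ext_alt)

lemma block_high: "u \<in> sym_ell1 G \<phi> \<Longrightarrow> proj G \<phi> (idx Z N) u = 0 \<Longrightarrow> B u = 0"
  using block_of_proj[of u] block_zero by simp

text \<open>The low part is multiplied by at most the norm of \<open>B\<close> and the high part is
  unchanged; additivity of the norm turns the two factors into their maximum.\<close>

lemma ext_bound:
  assumes u: "u \<in> sym_ell1 G \<phi>"
  shows "norm (ext u) \<le> max 1 (onorm_on (sym_ell1 G \<phi>) B) * norm u" (is "_ \<le> ?m * _")
proof -
  let ?l = "proj G \<phi> (idx Z N) u"
  have "norm (B ?l) \<le> ?m * norm ?l"
    using block_onorm[OF proj_sym[OF low_subset u]] by (rule order_trans) (simp add: mult_right_mono)
  moreover have "norm (u - ?l) \<le> ?m * norm (u - ?l)"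
    using mult_right_mono[of 1 ?m "norm (u - ?l)"] by simp
  ultimately have "norm (ext u) \<le> ?m * (norm ?l + norm (u - ?l))"
    using norm_triangle_ineq[of "B u" "u - ?l"]
    unfolding ext_alt distrib_left block_of_proj[OF u] by linarith
  then show ?thesis by (simp add: norm_proj_split[OF low_subset, of u, symmetric])
qed

text \<open>\<open>ext\<close> changes a sequence only by finitely supported ones, and these lie in
  every diagonal domain.\<close>

lemma ext_diag_dom:
  assumes u: "u \<in> diag_dom (sym_ell1 G \<phi>) L"
  shows "ext u \<in> diag_dom (sym_ell1 G \<phi>) L"
proof -
  have u': "u \<in> sym_ell1 G \<phi>" using u by (simp add: diag_dom_def)
  have "proj G \<phi> (idx Z N) (B u) \<in> diag_dom (sym_ell1 G \<phi>) L"
    "proj G \<phi> (idx Z N) u \<in> diag_dom (sym_ell1 G \<phi>) L"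
    by (intro finite_support_diag_dom block_sym low_subset finite_idx u')+
  then show ?thesis
    unfolding ext_alt proj_block[OF u']
    by (intro ell1.subspace_add ell1.subspace_diff subspace_diag_dom subspace_sym u)
qed

end

text \<open>Low and high parts do not mix: the blocks cancel on the former, and both extensions are
  the identity on the latter.\<close>

lemma (in symmetric_lattice) ext_inverse:
  assumes "low_block G \<phi> Z N B" "low_block G \<phi> Z N B'"
    and inv: "\<And>v. v \<in> sym_ell1 G \<phi> \<Longrightarrow> B' (B v) = proj G \<phi> (idx Z N) v"
    and u: "u \<in> sym_ell1 G \<phi>"
  shows "extend_block G \<phi> Z N B' (extend_block G \<phi> Z N B u) = (u :: ('p::finite \<times> 'm freq) ell1)"
proof -
  interpret B: low_block G \<phi> Z N B by fact
  interpret B': low_block G \<phi> Z N B' by fact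
  have "B' (B.ext u) = B' (proj G \<phi> (idx Z N) (B.ext u))"
    by (rule B'.block_of_proj[symmetric]) (rule B.ext_sym[OF u])
  also have "\<dots> = proj G \<phi> (idx Z N) u" by (simp add: B.ext_low[OF u] inv[OF u])
  finally show ?thesis
    unfolding B'.ext_alt[of "B.ext u"] B.ext_high[OF u] by simp
qed

section \<open>Column estimates for the pseudo-diagonalized operator\<close>

text \<open>The exact linearization is described by its symbol, a bounded symmetric part and its
  distance to the approximate one. That distance is stated on the intersection of the two domains,
  since these could differ a priori; \<open>dom_subset_bar\<close> relates them.\<close>

locale pseudo_diagonalization = symmetric_lattice G \<phi> Z
  for G :: "('g, 'b) monoid_scheme" and \<phi> :: "'g \<Rightarrow> 'm::finite freq \<Rightarrow> 'm freq" and Z +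
  fixes N :: nat and q :: "'p::finite \<Rightarrow> 'p \<Rightarrow> 'm freq ell1"
    and L_bar L_til :: "'p \<Rightarrow> 'm freq \<Rightarrow> complex"
    and Dg_bar Dg_til PN PN_inv :: "('p \<times> 'm freq) ell1 \<Rightarrow> ('p \<times> 'm freq) ell1"
    and eps :: real
  assumes conv: "block_convolution G \<phi> Z N q Dg_bar"
    and PN: "low_block G \<phi> Z N PN" and PN_inv: "low_block G \<phi> Z N PN_inv"
    and inverse: "\<And>v. v \<in> sym_ell1 G \<phi> \<Longrightarrow> PN (PN_inv v) = proj G \<phi> (idx Z N) v"
    and symbol: "\<And>j. orbit_constant G \<phi> (L_bar j)" "\<And>j. orbit_constant G \<phi> (L_til j)"
    and Dg_bar_sym: "\<And>v. v \<in> sym_ell1 G \<phi> \<Longrightarrow> Dg_bar v \<in> sym_ell1 G \<phi>"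
    and Dg_til_sym: "\<And>v. v \<in> sym_ell1 G \<phi> \<Longrightarrow> Dg_til v \<in> sym_ell1 G \<phi>"
    and Dg_til_linear: "clinear_on (sym_ell1 G \<phi>) Dg_til"
    and Dg_til_bound: "\<exists>C. \<forall>v\<in>sym_ell1 G \<phi>. norm (Dg_til v) \<le> C * norm v"
    and eps: "\<And>v. v \<in> diag_dom (sym_ell1 G \<phi>) L_bar \<inter> diag_dom (sym_ell1 G \<phi>) L_til \<Longrightarrow>
      norm (lin_op L_til Dg_til v - lin_op L_bar Dg_bar v) \<le> eps * norm v"
begin

sublocale Dg: block_convolution G \<phi> Z N q Dg_bar by (rule conv)
sublocale P: low_block G \<phi> Z N PN by (rule PN)
sublocale P_inv: low_block G \<phi> Z N PN_inv by (rule PN_inv)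

abbreviation "X \<equiv> (sym_ell1 G \<phi> :: ('p \<times> 'm freq) ell1 set)"
abbreviation "Dom \<equiv> diag_dom X L_til"
abbreviation "A_bar \<equiv> lin_op L_bar Dg_bar"
abbreviation "A_til \<equiv> lin_op L_til Dg_til"
abbreviation "e \<equiv> (orb_unit G \<phi> :: 'p \<Rightarrow> _)"
abbreviation "low \<equiv> idx Z N"
abbreviation "center \<equiv> gershgorin_center G \<phi> Z N PN PN_inv A_bar"
abbreviation "radius \<equiv> gershgorin_radius G \<phi> Z N PN PN_inv A_bar Dg_bar q eps"
abbreviation "r_inf \<equiv> radius_inf G \<phi> PN PN_inv eps"
abbreviation "wt r \<equiv> real (card (orbit G \<phi> r))"

section \<open>Symbols and domains of the two linearizations\<close>

lemma wt_pos: "0 < wt r"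
  using card_orbit_pos by simp

lemma P_P_inv: "u \<in> X \<Longrightarrow> P.ext (P_inv.ext u) = u"
  by (rule ext_inverse[OF PN_inv PN inverse])

lemma symbol_rep: "L_bar j (rep n) = L_bar j n" "L_til j (rep n) = L_til j n"
  by (simp_all only: orbit_constant_rep[OF symbol(1)] orbit_constant_rep[OF symbol(2)])

lemma e_X: "r \<in> Z \<Longrightarrow> e j r \<in> X"
  by (rule orb_unit_sym)

lemma eps_nonneg: "0 \<le> eps"
proof -
  \<comment> \<open>Any nonzero vector in both domains would do; component and frequency are
    arbitrary.\<close>
  let ?u = "e undefined (rep 0)"
  have "?u \<in> diag_dom X L_bar \<inter> Dom" using rep by (simp add: orb_unit_diag_dom)
  from order_trans[OF norm_ge_zero eps[OF this]] show ?thesis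
    using wt_pos[of "rep 0"] rep by (simp add: norm_orb_unit zero_le_mult_iff)
qed

text \<open>Closeness is known only for the sums of diagonal and bounded parts. Testing on units and
  removing the bounded parts isolates the difference of the symbols.\<close>

lemma symbol_difference_bounded: "\<exists>K. \<forall>j n. cmod (L_bar j n - L_til j n) \<le> K"
proof -
  obtain C where C: "\<And>v. v \<in> X \<Longrightarrow> norm (Dg_til v) \<le> C * norm v" using Dg_til_bound by blast
  have "cmod (L_bar j n - L_til j n) \<le> eps + C + (\<Sum>j\<in>UNIV. col_norm q j)" for j n
  proof -
    let ?r = "rep n"
    let ?u = "e j ?r"
    have r: "?r \<in> Z" by (rule rep)
    have dom: "?u \<in> diag_dom X L_bar" "?u \<in> Dom" using r by (simp_all add: orb_unit_diag_dom)
    have u: "fcoeff ?u (j, ?r) = 1" using r by (simp add: orb_unit_coeff)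
    \<comment> \<open>Cancelling both non-diagonal parts leaves the symbol difference times the
      unit.\<close>
    let ?v = "A_til ?u - A_bar ?u - Dg_til ?u + Dg_bar ?u"
    have v: "?v \<in> X"
      using r dom unfolding lin_op_def
      by (intro ell1.subspace_add ell1.subspace_diff subspace_sym diag_op_sym
          symbol Dg_bar_sym Dg_til_sym e_X)
    have coeff: "fcoeff ?v (j, ?r) = L_til j ?r - L_bar j ?r"
      by (simp add: lin_op_def fcoeff_diag_op[OF dom(1)] fcoeff_diag_op[OF dom(2)] u)
    have "cmod (L_til j ?r - L_bar j ?r) * wt ?r \<le> norm ?v"
      using orb_unit_sum_coeff_le[OF v r, of j] unfolding coeff .
    also have "\<dots> \<le> norm (A_til ?u - A_bar ?u) + norm (Dg_til ?u) + norm (Dg_bar ?u)"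
      using norm_triangle_ineq[of "A_til ?u - A_bar ?u - Dg_til ?u" "Dg_bar ?u"]
        norm_triangle_ineq4[of "A_til ?u - A_bar ?u" "Dg_til ?u"] by linarith
    also have "\<dots> \<le> eps * wt ?r + C * wt ?r + col_norm q j * wt ?r"
      using eps[of ?u] C[of ?u] Dg.column_norm[OF r, of j] dom e_X[OF r] r
      by (simp add: norm_orb_unit)
    also have "\<dots> = (eps + C + col_norm q j) * wt ?r" by (simp add: algebra_simps)
    finally have "cmod (L_til j ?r - L_bar j ?r) \<le> eps + C + col_norm q j"
      using wt_pos[of ?r] by simp
    moreover have "col_norm q j \<le> (\<Sum>j\<in>UNIV. col_norm q j)"
      by (rule member_le_sum) (simp_all add: col_norm_def sum_nonneg)
    moreover have "L_til j n = L_til j ?r" "L_bar j n = L_bar j ?r"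
      by (simp_all add: symbol_rep)
    ultimately show ?thesis by (simp add: norm_minus_commute)
  qed
  then show ?thesis by blast
qed

lemma dom_subset_bar: "Dom \<subseteq> diag_dom X L_bar"
  using symbol_difference_bounded by (auto intro: subsetD[OF diag_dom_mono])

lemma dom_X: "Dom \<subseteq> X"
  by (auto simp: diag_dom_def)

lemma subspace_dom: "ell1.subspace Dom"
  by (rule subspace_diag_dom[OF subspace_sym])

lemma A_til_linear: "clinear_on Dom A_til"
  using clinear_on_diag_op[OF subspace_sym, of L_til] Dg_til_linear dom_X
  by (auto simp: clinear_on_def lin_op_def subset_iff ell1.scale_right_distrib)

lemma A_til_X: "v \<in> Dom \<Longrightarrow> A_til v \<in> X"
  unfolding lin_op_def using dom_X
  by (intro ell1.subspace_add subspace_sym diag_op_sym symbol Dg_til_sym) auto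

lemma A_bar_X: "v \<in> Dom \<Longrightarrow> A_bar v \<in> X"
  unfolding lin_op_def using dom_X dom_subset_bar
  by (intro ell1.subspace_add subspace_sym diag_op_sym symbol Dg_bar_sym) auto

section \<open>Columns of the pseudo-diagonalized approximate operator\<close>

lemma ext_column_low: "r \<in> low \<Longrightarrow> P.ext (e j r) = PN (e j r)"
proof -
  assume r: "r \<in> low"
  then have "r \<in> Z" using P.low_subset by blast
  then have "proj G \<phi> low (e j r) = e j r"
    using r by (intro ell1_eqI) (auto simp: proj_coeff[OF P.low_subset] orb_unit_coeff)
  then show ?thesis by (simp add: P.ext_alt)
qed

lemma proj_unit_high: "r \<in> Z \<Longrightarrow> r \<notin> low \<Longrightarrow> proj G \<phi> low (e j r) = 0"
  using P.low_subset by (intro ell1_eqI) (auto simp: proj_coeff orb_unit_coeff)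

lemma P_high: "u \<in> X \<Longrightarrow> proj G \<phi> low u = 0 \<Longrightarrow> P.ext u = u"
  and P_inv_high: "u \<in> X \<Longrightarrow> proj G \<phi> low u = 0 \<Longrightarrow> P_inv.ext u = u"
  by (simp_all add: P.ext_alt P_inv.ext_alt P.block_high P_inv.block_high)

lemma proj_diag_op:
  assumes "v \<in> diag_dom X' L" "proj G \<phi> low v = 0"
  shows "proj G \<phi> low (diag_op L v) = 0"
proof (rule ell1_eqI, clarify)
  fix j n
  have "fcoeff (proj G \<phi> low v) (j, n) = 0" using assms(2) by simp
  then show "fcoeff (proj G \<phi> low (diag_op L v)) (j, n) = fcoeff 0 (j, n)"
    by (auto simp: proj_coeff[OF P.low_subset] fcoeff_diag_op[OF assms(1)])
qed

lemma ext_coeff_high: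
  "u \<in> X \<Longrightarrow> rep k \<notin> low \<Longrightarrow> fcoeff (P_inv.ext u) (i, k) = fcoeff u (i, k)"
  using arg_cong[OF P_inv.ext_high[of u], of "\<lambda>w. fcoeff w (i, k)"]
  by (simp add: proj_coeff[OF P.low_subset])

text \<open>On a high unit \<open>P\<close> is the identity, and the diagonal part of the image is
  again high, so only the convolution part feels the inverse of \<open>P\<close>.\<close>

lemma pseudo_column_high:
  assumes r: "r \<in> Z" "r \<notin> low"
  shows "pseudo_diag G \<phi> Z N PN PN_inv A_bar (e j r) =
      diag_op L_bar (e j r) + P_inv.ext (Dg_bar (e j r))"
    and "center r j = L_bar j r + fcoeff (Dg_bar (e j r)) (j, r)"
proof -
  let ?u = "e j r"
  have dom: "?u \<in> diag_dom X L_bar" using r by (simp add: orb_unit_diag_dom)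
  have d: "proj G \<phi> low (diag_op L_bar ?u) = 0" "diag_op L_bar ?u \<in> X"
    using proj_diag_op[OF dom] proj_unit_high[OF r] diag_op_sym[OF symbol(1) dom] by simp_all
  have "pseudo_diag G \<phi> Z N PN PN_inv A_bar ?u = P_inv.ext (diag_op L_bar ?u + Dg_bar ?u)"
    using P_high[OF e_X proj_unit_high] r by (simp add: pseudo_diag_def lin_op_def)
  also have "\<dots> = P_inv.ext (diag_op L_bar ?u) + P_inv.ext (Dg_bar ?u)"
    using P_inv.ext_linear d(2) Dg_bar_sym[OF e_X[OF r(1)]] unfolding clinear_on_def by blast
  finally show eq: "pseudo_diag G \<phi> Z N PN PN_inv A_bar ?u =
      diag_op L_bar ?u + P_inv.ext (Dg_bar ?u)"
    using P_inv_high[OF d(2,1)] by simp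
  show "center r j = L_bar j r + fcoeff (Dg_bar ?u) (j, r)"
    using r ext_coeff_high[OF Dg_bar_sym[OF e_X[OF r(1)]]]
    by (simp add: gershgorin_center_def entry_def eq fcoeff_diag_op[OF dom] orb_unit_coeff rep_ident)
qed

text \<open>\<open>P\<close> sends a low unit to a low vector \<open>?w\<close>. The low part of the
  residual is a finite matrix column without its diagonal entry; the high part comes from
  \<open>Dg_bar ?w\<close> alone. These give the two sums in \<open>radius_low\<close>.\<close>

lemma column_residual_low:
  assumes r: "r \<in> low"
  shows "norm (pseudo_diag G \<phi> Z N PN PN_inv A_bar (e j r) - center r j *\<^sub>C e j r)
    \<le> radius_low G \<phi> Z N PN PN_inv A_bar Dg_bar r j * wt r"
proof -
  let ?M = "pseudo_diag G \<phi> Z N PN PN_inv A_bar (e j r)"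
  let ?U = "?M - center r j *\<^sub>C e j r"
  let ?w = "PN (e j r)"
  have rZ: "r \<in> Z" using r P.low_subset by blast
  have w: "?w \<in> X" "proj G \<phi> low ?w = ?w"
    using P.block_sym[OF e_X[OF rZ]] P.proj_block[OF e_X[OF rZ]] by simp_all
  then have w_dom: "?w \<in> Dom" "?w \<in> diag_dom X L_bar"
    using finite_support_diag_dom[OF w(1) P.low_subset finite_idx] by simp_all
  have M: "?M = P_inv.ext (A_bar ?w)" by (simp add: pseudo_diag_def ext_column_low[OF r])
  have MX: "?M \<in> X" unfolding M by (rule P_inv.ext_sym[OF A_bar_X[OF w_dom(1)]])
  have UX: "?U \<in> X"
    by (intro ell1.subspace_diff ell1.subspace_scale subspace_sym MX e_X rZ)
  \<comment> \<open>At high indices \<open>?w\<close> and the unit vanish, which removes the symbol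
    and the center; the support of the convolution stops at \<open>3 * N\<close>.\<close>
  have "?U - proj G \<phi> low ?U = proj G \<phi> (idx Z (3 * N) - low) (Dg_bar ?w)"
  proof (rule ell1_eqI, clarify)
    fix i k
    have w0: "fcoeff ?w (i, k) = 0" if "rep k \<notin> low"
      using that arg_cong[OF w(2), of "\<lambda>w. fcoeff w (i, k)"] by (simp add: proj_coeff[OF P.low_subset])
    have e0: "fcoeff (e j r) (i, k) = 0" if "rep k \<notin> low"
      using that r by (auto simp: orb_unit_coeff[OF rZ])
    have M0: "fcoeff ?M (i, k) = fcoeff (Dg_bar ?w) (i, k)" if "rep k \<notin> low"
      unfolding M ext_coeff_high[OF A_bar_X[OF w_dom(1)] that]
      by (simp add: lin_op_def fcoeff_diag_op[OF w_dom(2)] w0[OF that])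
    have "idx Z (3 * N) - low \<subseteq> Z" using Dg.idx_subset by blast
    then show "fcoeff (?U - proj G \<phi> low ?U) (i, k) =
        fcoeff (proj G \<phi> (idx Z (3 * N) - low) (Dg_bar ?w)) (i, k)"
      using Dg.low_support[OF w, of k i]
      by (auto simp: proj_coeff P.low_subset M0 e0)
  qed
  also have "norm \<dots> = (\<Sum>i\<in>UNIV. \<Sum>k\<in>idx Z (3 * N) - low. wt k * cmod (fcoeff (Dg_bar ?w) (i, k)))"
    by (rule norm_proj_finite[OF _ _ Dg_bar_sym[OF w(1)]])
       (use Dg.idx_subset in \<open>auto simp: finite_idx\<close>)
  also have "\<dots> = (\<Sum>k\<in>idx Z (3 * N) - low. \<Sum>i\<in>UNIV.
      cmod (entry G \<phi> (\<lambda>v. Dg_bar (PN v)) i j k r) * wt k)"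
    by (subst sum.swap) (simp add: entry_def mult.commute)
  finally have high: "norm (?U - proj G \<phi> low ?U) = \<dots>" .
  have "norm (proj G \<phi> low ?U) = (\<Sum>i\<in>UNIV. \<Sum>k\<in>low. wt k * cmod (fcoeff ?U (i, k)))"
    by (rule norm_proj_finite[OF P.low_subset finite_idx UX])
  also have "\<dots> = (\<Sum>(k, i)\<in>low \<times> UNIV. wt k * cmod (fcoeff ?U (i, k)))"
    by (subst sum.swap) (simp add: sum.cartesian_product)
  \<comment> \<open>The center is the diagonal entry itself, so its term is 0.\<close>
  also have "\<dots> = (\<Sum>(k, i)\<in>low \<times> UNIV - {(r, j)}. wt k * cmod (fcoeff ?U (i, k)))"
    by (rule sum.mono_neutral_right)
       (auto simp: finite_idx gershgorin_center_def entry_def orb_unit_coeff[OF rZ] rep_ident[OF rZ])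
  also have "\<dots> = (\<Sum>(k, i)\<in>low \<times> UNIV - {(r, j)}.
      cmod (entry G \<phi> (pseudo_diag G \<phi> Z N PN PN_inv A_bar) i j k r) * wt k)"
    using P.low_subset
    by (intro sum.cong) (auto simp: entry_def orb_unit_coeff[OF rZ] rep_ident subset_iff split: if_splits)
  finally have low: "norm (proj G \<phi> low ?U) = \<dots>" .
  show ?thesis
    using norm_proj_split[OF P.low_subset, of ?U] wt_pos[of r]
    unfolding low high by (simp add: radius_low_def)
qed

text \<open>The low part is \<open>PN_inv\<close> applied to the convolution column. The high part
  is that column without its diagonal entry, hence bounded by its full norm.\<close>

lemma column_residual_high:
  assumes r: "r \<in> Z" "r \<notin> low"
  shows "norm (pseudo_diag G \<phi> Z N PN PN_inv A_bar (e j r) - center r j *\<^sub>C e j r)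
    \<le> (\<Sum>k\<in>low. \<Sum>i\<in>UNIV. cmod (entry G \<phi> (\<lambda>v. PN_inv (Dg_bar v)) i j k r) * wt k)
      + col_norm q j * wt r"
proof -
  let ?M = "pseudo_diag G \<phi> Z N PN PN_inv A_bar (e j r)"
  let ?U = "?M - center r j *\<^sub>C e j r"
  let ?D = "Dg_bar (e j r)"
  have u_dom: "e j r \<in> diag_dom X L_bar" using r by (simp add: orb_unit_diag_dom)
  have DX: "?D \<in> X" by (rule Dg_bar_sym[OF e_X[OF r(1)]])
  note M = pseudo_column_high(1)[OF r, of j]
  have "proj G \<phi> low ?U = PN_inv ?D"
    using proj_diag_op[OF u_dom proj_unit_high[OF r]] proj_unit_high[OF r]
    by (simp add: M proj_diff proj_add proj_cscale P_inv.ext_low[OF DX])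
  then have "norm (proj G \<phi> low ?U) = norm (proj G \<phi> low (PN_inv ?D))"
    by (simp add: P_inv.proj_block[OF DX])
  also have "\<dots> = (\<Sum>i\<in>UNIV. \<Sum>k\<in>low. wt k * cmod (fcoeff (PN_inv ?D) (i, k)))"
    by (rule norm_proj_finite[OF P.low_subset finite_idx P_inv.block_sym[OF DX]])
  also have "\<dots> = (\<Sum>k\<in>low. \<Sum>i\<in>UNIV. cmod (entry G \<phi> (\<lambda>v. PN_inv (Dg_bar v)) i j k r) * wt k)"
    by (subst sum.swap) (simp add: entry_def mult.commute)
  finally have low: "norm (proj G \<phi> low ?U) = \<dots>" .
  have "norm (?U - proj G \<phi> low ?U) \<le> norm ?D"
  proof (rule norm_ell1_mono, clarify)
    fix i k
    show "cmod (fcoeff (?U - proj G \<phi> low ?U) (i, k)) \<le> cmod (fcoeff ?D (i, k))"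
    proof (cases "rep k \<in> low")
      case True
      then show ?thesis by (simp add: proj_coeff[OF P.low_subset])
    next
      case False
      \<comment> \<open>On the orbit of \<open>r\<close> in component \<open>j\<close> the
        subtraction of the center gives 0, by constancy of symbol and column along orbits; elsewhere
        only the column of \<open>Dg_bar\<close> remains.\<close>
      have "L_bar i k = L_bar i (rep k)" by (simp add: symbol_rep)
      moreover have "fcoeff ?D (i, rep k) = fcoeff ?D (i, k)" by (rule sym_rep[OF DX])
      ultimately show ?thesis
        using False by (auto simp: proj_coeff[OF P.low_subset] M ext_coeff_high[OF DX]
            fcoeff_diag_op[OF u_dom] orb_unit_coeff[OF r(1)] pseudo_column_high(2)[OF r])
    qed
  qed
  also have "\<dots> \<le> col_norm q j * wt r" by (rule Dg.column_norm[OF r(1)])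
  finally show ?thesis
    using norm_proj_split[OF P.low_subset, of ?U] low by simp
qed

lemma column_residual:
  assumes r: "r \<in> Z"
  shows "norm (pseudo_diag G \<phi> Z N PN PN_inv A_bar (e j r) - center r j *\<^sub>C e j r)
    \<le> (radius r j - r_inf) * wt r"
proof (cases "r \<in> low")
  case True
  then show ?thesis using column_residual_low by (simp add: gershgorin_radius_def)
next
  case False
  show ?thesis
  proof (cases "r \<in> idx Z (3 * N)")
    case True
    then show ?thesis
      using column_residual_high[OF r False, of j] False wt_pos[of r]
      by (simp add: gershgorin_radius_def radius_mid_def distrib_right)
  next
    case far: False
    have DX: "Dg_bar (e j r) \<in> X" by (rule Dg_bar_sym[OF e_X[OF r(1)]])
    \<comment> \<open>Beyond \<open>3 * N\<close> the convolution no longer reaches the low indices,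
      so the matrix sum disappears and only the kernel norm is left.\<close>
    have "proj G \<phi> low (Dg_bar (e j r)) = 0"
      using Dg.column_support_high[OF r far] by (intro ell1_eqI) (auto simp: proj_coeff P.low_subset)
    then have "PN_inv (Dg_bar (e j r)) = 0" by (rule P_inv.block_high[OF DX])
    then show ?thesis
      using column_residual_high[OF r False, of j] False far
      by (simp add: gershgorin_radius_def entry_def)
  qed
qed

section \<open>Residual of the exact operator and its column bound\<close>

definition center' :: "'p \<Rightarrow> 'm freq \<Rightarrow> complex" where
  "center' j n = center (rep n) j"

text \<open>Only finitely many low centers have no explicit form; a high center is
  \<open>L_bar\<close> plus one entry of a bounded convolution column. Hence the diagonal operator
  with symbol \<open>center'\<close> is defined on all of \<open>Dom\<close>.\<close>

lemma center'_near_symbol: "\<exists>K. \<forall>j n. cmod (center' j n - L_til j n) \<le> K"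
proof -
  obtain K where K: "\<And>j n. cmod (L_bar j n - L_til j n) \<le> K"
    using symbol_difference_bounded by blast
  define K1 where "K1 = (\<Sum>j\<in>UNIV. \<Sum>r\<in>low. cmod (center r j - L_til j r))"
  define K2 where "K2 = (\<Sum>j\<in>UNIV. col_norm q j)"
  have col_nonneg: "0 \<le> col_norm q j" for j by (simp add: col_norm_def sum_nonneg)
  have K1: "0 \<le> K1" by (simp add: K1_def sum_nonneg)
  have K2: "0 \<le> K2" "col_norm q j \<le> K2" for j
    using col_nonneg by (auto simp: K2_def intro!: member_le_sum sum_nonneg)
  have "cmod (center' j n - L_til j n) \<le> K1 + K2 + \<bar>K\<bar>" for j n
  proof -
    let ?r = "rep n"
    have L: "L_til j n = L_til j ?r" by (simp add: symbol_rep)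
    show ?thesis
    proof (cases "?r \<in> low")
      case True
      have "cmod (center ?r j - L_til j ?r) \<le> (\<Sum>r\<in>low. cmod (center r j - L_til j r))"
        by (rule member_le_sum[OF True]) (simp_all add: finite_idx)
      also have "\<dots> \<le> K1"
        unfolding K1_def by (rule member_le_sum) (simp_all add: sum_nonneg)
      finally show ?thesis using K2(1) unfolding center'_def L by linarith
    next
      case False
      let ?D = "Dg_bar (e j ?r)"
      have "cmod (fcoeff ?D (j, ?r)) * wt ?r \<le> col_norm q j * wt ?r"
        using orb_unit_sum_coeff_le[OF Dg_bar_sym[OF e_X[OF rep(1)]] rep(1), of j n j n]
          Dg.column_norm[OF rep(1), of j n] by (rule order_trans)
      then have "cmod (fcoeff ?D (j, ?r)) \<le> K2" using wt_pos[of ?r] K2(2)[of j] by simp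
      moreover have eq: "center ?r j - L_til j ?r = (L_bar j ?r - L_til j ?r) + fcoeff ?D (j, ?r)"
        by (simp add: pseudo_column_high(2)[OF rep(1) False])
      ultimately show ?thesis
        using K[of j ?r] K1 norm_triangle_ineq[of "L_bar j ?r - L_til j ?r" "fcoeff ?D (j, ?r)"]
        unfolding center'_def L eq by linarith
    qed
  qed
  then show ?thesis by blast
qed

lemma dom_subset_center': "Dom \<subseteq> diag_dom X center'"
  using center'_near_symbol by (auto intro: subsetD[OF diag_dom_mono])

text \<open>The remainder after conjugating the exact operator by \<open>P\<close> and removing the
  diagonal of centers; it serves as \<open>R\<close> in \<open>column_gershgorin\<close>.\<close>

definition residual :: "('p \<times> 'm freq) ell1 \<Rightarrow> ('p \<times> 'm freq) ell1" where
  "residual v = P_inv.ext (A_til (P.ext v)) - diag_op center' v"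

lemma residual_linear: "clinear_on Dom residual"
proof (rule clinear_onI)
  have D: "clinear_on (diag_dom X center') (diag_op center')"
    by (rule clinear_on_diag_op[OF subspace_sym])
  fix u assume u: "u \<in> Dom"
  show "residual (c *\<^sub>C u) = c *\<^sub>C residual u" for c
    using P.ext_linear P_inv.ext_linear A_til_linear D u dom_X dom_subset_center'
      P.ext_diag_dom[of u] A_til_X[of "P.ext u"]
    by (auto simp: residual_def clinear_on_def subset_iff ell1.scale_right_diff_distrib)
  show "residual (u + v) = residual u + residual v" if v: "v \<in> Dom" for v
    using P.ext_linear P_inv.ext_linear A_til_linear D u v dom_X dom_subset_center'
      P.ext_diag_dom[of u] A_til_X[of "P.ext u"] P.ext_diag_dom[of v] A_til_X[of "P.ext v"]
    by (auto simp: residual_def clinear_on_def subset_iff)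
qed

text \<open>On high sequences the unbounded diagonal parts nearly cancel, leaving a bounded
  multiplier and a bounded operator. This is the tail hypothesis of
  \<open>norm_le_weighted_columns\<close>, where the size of the constant does not affect the
  result.\<close>

lemma residual_high: "\<exists>C. \<forall>u\<in>Dom. proj G \<phi> low u = 0 \<longrightarrow> norm (residual u) \<le> C * norm u"
proof -
  obtain K where K: "\<And>j n. cmod (center' j n - L_til j n) \<le> K"
    using center'_near_symbol by blast
  obtain C where C: "\<And>v. v \<in> X \<Longrightarrow> norm (Dg_til v) \<le> C * norm v" using Dg_til_bound by blast
  let ?m = "max 1 (onorm_on X PN_inv)"
  have "norm (residual u) \<le> (\<bar>K\<bar> + ?m * C) * norm u" if u: "u \<in> Dom" "proj G \<phi> low u = 0" for u
  proof -
    let ?L = "diag_op L_til u"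
    have uX: "u \<in> X" using u dom_X by blast
    have LX: "?L \<in> X" by (rule diag_op_sym[OF symbol(2) u(1)])
    have "P_inv.ext (A_til (P.ext u)) = P_inv.ext ?L + P_inv.ext (Dg_til u)"
      using P_inv.ext_linear LX Dg_til_sym[OF uX] P_high[OF uX u(2)]
      by (simp add: lin_op_def clinear_on_def)
    then have eq: "residual u = (?L - diag_op center' u) + P_inv.ext (Dg_til u)"
      using P_inv_high[OF LX proj_diag_op[OF u]] by (simp add: residual_def)
    moreover have "norm (?L - diag_op center' u) \<le> norm (\<bar>K\<bar> *\<^sub>R u)"
    proof (rule norm_ell1_mono, clarify)
      fix j n
      have "u \<in> diag_dom X center'" using u dom_subset_center' by blast
      then have "fcoeff (?L - diag_op center' u) (j, n) = (L_til j n - center' j n) * fcoeff u (j, n)"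
        by (simp add: fcoeff_diag_op[OF u(1)] fcoeff_diag_op left_diff_distrib)
      then show "cmod (fcoeff (?L - diag_op center' u) (j, n)) \<le> cmod (fcoeff (\<bar>K\<bar> *\<^sub>R u) (j, n))"
        using K[of j n] by (auto simp: norm_mult norm_minus_commute intro!: mult_right_mono)
    qed
    moreover have "norm (P_inv.ext (Dg_til u)) \<le> ?m * (C * norm u)"
      using P_inv.ext_bound[OF Dg_til_sym[OF uX]] C[OF uX]
      by (meson mult_left_mono max.cobounded1 order_trans zero_le_one)
    ultimately show ?thesis
      using norm_triangle_ineq[of "?L - diag_op center' u" "P_inv.ext (Dg_til u)"]
      unfolding eq distrib_right norm_scaleR abs_abs mult.assoc by linarith
  qed
  then show ?thesis by blast
qed

text \<open>Split the exact operator into the approximate one and the error. The first contributes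
  \<open>column_residual\<close>, the second \<open>r_inf\<close>, with one factor each for the
  inverse of \<open>P\<close>, the error and \<open>P\<close>.\<close>

lemma residual_column:
  assumes r: "r \<in> Z"
  shows "norm (residual (e j r)) \<le> radius r j * wt r"
proof -
  let ?u = "e j r" and ?m = "max 1 (onorm_on X PN)" and ?m' = "max 1 (onorm_on X PN_inv)"
  let ?E = "\<lambda>v. A_til v - A_bar v"
  have u: "?u \<in> Dom" "?u \<in> X" "?u \<in> diag_dom X center'"
    using r by (simp_all add: orb_unit_diag_dom e_X)
  have Pu: "P.ext ?u \<in> Dom" by (rule P.ext_diag_dom[OF u(1)])
  have EX: "?E (P.ext ?u) \<in> X"
    by (intro ell1.subspace_diff subspace_sym A_til_X A_bar_X Pu)
  have diag: "diag_op center' ?u = center r j *\<^sub>C ?u"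
    by (rule ell1_eqI) (auto simp: fcoeff_diag_op[OF u(3)] orb_unit_coeff[OF r] center'_def)
  have "P_inv.ext (A_til (P.ext ?u)) = P_inv.ext (A_bar (P.ext ?u) + ?E (P.ext ?u))" by simp
  also have "\<dots> = P_inv.ext (A_bar (P.ext ?u)) + P_inv.ext (?E (P.ext ?u))"
    using P_inv.ext_linear A_bar_X[OF Pu] EX unfolding clinear_on_def by blast
  finally have eq: "residual ?u = (pseudo_diag G \<phi> Z N PN PN_inv A_bar ?u - center r j *\<^sub>C ?u)
      + P_inv.ext (?E (P.ext ?u))"
    by (simp add: residual_def diag pseudo_diag_def)
  moreover have "norm (P_inv.ext (?E (P.ext ?u))) \<le> r_inf * wt r"
  proof -
    have "norm (P_inv.ext (?E (P.ext ?u))) \<le> ?m' * norm (?E (P.ext ?u))"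
      by (rule P_inv.ext_bound[OF EX])
    also have "\<dots> \<le> ?m' * (eps * norm (P.ext ?u))"
      using Pu dom_subset_bar by (intro mult_left_mono eps) auto
    also have "\<dots> \<le> ?m' * (eps * (?m * norm ?u))"
      by (intro mult_left_mono P.ext_bound u eps_nonneg) simp
    finally show ?thesis by (simp add: radius_inf_def norm_orb_unit[OF r] mult_ac)
  qed
  ultimately show ?thesis
    using norm_triangle_ineq[of "pseudo_diag G \<phi> Z N PN PN_inv A_bar ?u - center r j *\<^sub>C ?u"
        "P_inv.ext (?E (P.ext ?u))"] column_residual[OF r, of j]
    unfolding eq left_diff_distrib by linarith
qed

lemma radius_nonneg: "0 \<le> radius r j"
  using eps_nonneg
  by (auto simp: gershgorin_radius_def radius_low_def radius_mid_def radius_inf_def col_norm_def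
      intro!: add_nonneg_nonneg mult_nonneg_nonneg divide_nonneg_nonneg sum_nonneg)

text \<open>Outside the finite set \<open>idx Z (3 * N)\<close> the radius depends on the component
  only, and there are finitely many components.\<close>

lemma radius_bounded: "\<exists>B. \<forall>r j. radius r j \<le> B"
proof -
  define B1 where "B1 = (\<Sum>j\<in>UNIV. \<Sum>r\<in>idx Z (3 * N). radius r j)"
  define B2 where "B2 = (\<Sum>j\<in>UNIV. col_norm q j) + r_inf"
  have col_nonneg: "0 \<le> col_norm q j" for j by (simp add: col_norm_def sum_nonneg)
  have inf: "0 \<le> r_inf" using eps_nonneg by (simp add: radius_inf_def)
  have B2: "0 \<le> B2" using col_nonneg inf by (simp add: B2_def sum_nonneg)
  have "radius r j \<le> B1 + B2" for r j
  proof (cases "r \<in> idx Z (3 * N)")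
    case True
    have "radius r j \<le> (\<Sum>r\<in>idx Z (3 * N). radius r j)"
      by (rule member_le_sum[OF True]) (simp_all add: finite_idx radius_nonneg)
    also have "\<dots> \<le> B1"
      unfolding B1_def by (rule member_le_sum) (simp_all add: radius_nonneg sum_nonneg)
    finally show ?thesis using B2 by linarith
  next
    case False
    then have "r \<notin> low" by (auto simp: idx_def)
    then have "radius r j = col_norm q j + r_inf" using False by (simp add: gershgorin_radius_def)
    also have "\<dots> \<le> B2"
      unfolding B2_def using col_nonneg by (intro add_right_mono member_le_sum) auto
    finally show ?thesis by (simp add: B1_def radius_nonneg sum_nonneg add_increasing)
  qed
  then show ?thesis by blast
qed

text \<open>The abstract argument runs on the full lattice, with each reduced center and radius
  repeated along its orbit.\<close>

sublocale gersh: column_gershgorin Dom residual "\<lambda>x. center (rep (snd x)) (fst x)"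
  "\<lambda>x. radius (rep (snd x)) (fst x)"
proof
  show "0 \<le> radius (rep (snd x)) (fst x)" for x by (rule radius_nonneg)
  show "\<exists>B. \<forall>x. radius (rep (snd x)) (fst x) \<le> B" using radius_bounded by blast
  fix v assume v: "v \<in> Dom"
  obtain C where C: "\<And>u. u \<in> Dom \<Longrightarrow> proj G \<phi> low u = 0 \<Longrightarrow> norm (residual u) \<le> C * norm u"
    using residual_high by blast
  obtain B where B: "\<And>r j. radius r j \<le> B" using radius_bounded by blast
  show "norm (residual v) \<le> (\<Sum>\<^sub>\<infinity>x. radius (rep (snd x)) (fst x) * cmod (fcoeff v x))"
    by (rule norm_le_weighted_columns[where c = "\<lambda>j r. radius r j" and D = Dom,
          OF subspace_dom dom_X _ residual_linear P.low_subset finite_idx C])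
       (use v B radius_nonneg residual_column in \<open>auto simp: orb_unit_diag_dom\<close>)
qed

end

section \<open>Separation of disjoint balls, and symmetry of derivatives\<close>

lemma cball_disjoint_imp_dist:
  fixes a b :: "'a::real_normed_vector"
  assumes disj: "cball a r \<inter> cball b s = {}" and r: "0 \<le> r" and s: "0 \<le> s"
  shows "r + s < dist a b"
proof (rule ccontr)
  assume le: "\<not> r + s < dist a b"
  have "b \<in> cball b s" using s by simp
  then have far: "r < dist a b" using disj by (auto simp: not_le[symmetric])
  then have ne: "a \<noteq> b" using r by auto
  \<comment> \<open>The point at distance \<open>r\<close> from \<open>a\<close> on the segment to
    \<open>b\<close>; it would lie in both balls. By \<open>far\<close> it comes before
    \<open>b\<close>.\<close>
  define p where "p = a + (r / dist a b) *\<^sub>R (b - a)"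
  have "dist a p = r" using ne r by (simp add: p_def dist_norm norm_minus_commute)
  moreover have "b - p = (1 - r / dist a b) *\<^sub>R (b - a)"
    by (simp add: p_def algebra_simps)
  then have "dist b p = (1 - r / dist a b) * dist a b"
    using far r by (simp add: dist_norm norm_minus_commute divide_le_eq)
  then have "dist b p = dist a b - r" using ne by (simp add: left_diff_distrib)
  ultimately have "p \<in> cball a r \<inter> cball b s" using le by simp
  with disj show False by blast
qed

text \<open>The functional \<open>F\<close> measures a defect of symmetry. It is constantly 0 on the
  values of \<open>g\<close> along a line in the symmetric subspace, so its derivative in the
  direction \<open>v\<close> is 0.\<close>

lemma (in symmetric_lattice) derivative_sym:
  fixes g :: "('p \<times> 'm freq) ell1 \<Rightarrow> ('p \<times> 'm freq) ell1"
  assumes g: "\<And>u. u \<in> sym_ell1 G \<phi> \<Longrightarrow> g u \<in> sym_ell1 G \<phi>"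
    and D: "(g has_derivative D) (at u within sym_ell1 G \<phi>)"
    and u: "u \<in> sym_ell1 G \<phi>" and v: "v \<in> sym_ell1 G \<phi>"
  shows "D v \<in> sym_ell1 G \<phi>"
  unfolding sym_iff
proof (intro allI)
  fix j n
  define F where "F w = fcoeff w (j, n) - fcoeff w (j, rep n)" for w :: "('p \<times> 'm freq) ell1"
  have F: "bounded_linear F"
    unfolding F_def by (intro bounded_linear_sub bounded_linear_fcoeff)
  have line: "u + t *\<^sub>R v \<in> sym_ell1 G \<phi>" for t
    using u v by (simp add: sym_iff)
  \<comment> \<open>Restriction to the line turns a derivative within the subspace into an ordinary
    one in the real parameter.\<close>
  have "((\<lambda>w. F (g w)) has_derivative (\<lambda>w. F (D w))) (at (u + 0 *\<^sub>R v) within range (\<lambda>t. u + t *\<^sub>R v))"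
    using has_derivative_subset[OF bounded_linear.has_derivative[OF F D],
        of "range (\<lambda>t. u + t *\<^sub>R v)"] line by (simp add: image_subset_iff)
  moreover have "((\<lambda>t. u + t *\<^sub>R v) has_derivative (\<lambda>t. t *\<^sub>R v)) (at 0)"
    by (auto intro!: derivative_eq_intros)
  ultimately have "((\<lambda>t. F (g (u + t *\<^sub>R v))) has_derivative (\<lambda>t. F (D (t *\<^sub>R v)))) (at 0)"
    by (rule has_derivative_in_compose[rotated])
  moreover have "F (g (u + t *\<^sub>R v)) = 0" for t
    using g[OF line] by (simp add: F_def sym_rep)
  ultimately have "((\<lambda>t::real. 0 :: complex) has_derivative (\<lambda>t. F (D (t *\<^sub>R v)))) (at 0)" by simp
  then have "(\<lambda>t. F (D (t *\<^sub>R v))) = (\<lambda>t. 0)"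
    by (rule has_derivative_unique) simp
  then have "F (D (1 *\<^sub>R v)) = 0" by metis
  then show "fcoeff (D v) (j, n) = fcoeff (D v) (j, rep n)" by (simp add: F_def)
qed


section \<open>Eigenvalues of the perturbed operator\<close>

context pseudo_diagonalization
begin

text \<open>Applying the inverse of \<open>P\<close> to an eigenvalue equation with source, and
  inserting \<open>P\<close> times its inverse before \<open>v\<close>, gives the coordinate form
  that the Gershgorin argument takes as input.\<close>

lemma transported_eq:
  assumes v: "v \<in> Dom" and y: "y \<in> X" and eq: "A_til v = z *\<^sub>C v + \<delta> *\<^sub>C y"
  shows "(z - center (rep (snd x)) (fst x)) * fcoeff (P_inv.ext v) x + \<delta> * fcoeff (P_inv.ext y) x
    = fcoeff (residual (P_inv.ext v)) x"
proof -
  have vX: "v \<in> X" using v dom_X by blast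
  have "P_inv.ext v \<in> diag_dom X center'"
    using P_inv.ext_diag_dom[OF v] dom_subset_center' by blast
  note D = fcoeff_diag_op[OF this, of "fst x" "snd x", simplified]
  have scaled: "z *\<^sub>C v \<in> X" "\<delta> *\<^sub>C y \<in> X"
    by (intro ell1.subspace_scale subspace_sym vX y)+
  have "P_inv.ext (A_til v) = P_inv.ext (z *\<^sub>C v) + P_inv.ext (\<delta> *\<^sub>C y)"
    unfolding eq using P_inv.ext_linear scaled unfolding clinear_on_def by blast
  also have "\<dots> = z *\<^sub>C P_inv.ext v + \<delta> *\<^sub>C P_inv.ext y"
    using P_inv.ext_linear vX y unfolding clinear_on_def by simp
  finally show ?thesis
    by (simp add: residual_def P_P_inv[OF vX] D center'_def algebra_simps)
qed

lemma P_inv_eq_0: "v \<in> X \<Longrightarrow> P_inv.ext v = 0 \<Longrightarrow> v = 0"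
  using P_P_inv[of v] P.ext_linear clinear_on_zero[OF P.ext_linear] ell1.subspace_0[OF subspace_sym]
  by simp

text \<open>If \<open>z\<close> avoids every disk, all gaps are strict, and the source-free case
  with \<open>S\<close> empty annihilates the eigenvector.\<close>

lemma eigenvalue_in_disk:
  assumes "z \<in> eigenvalues Dom A_til"
  obtains r j where "r \<in> Z" "z \<in> cball (center r j) (radius r j)"
proof (rule ccontr)
  assume "\<not> thesis"
  with that have far: "radius r j < cmod (z - center r j)" if "r \<in> Z" for r j
    using \<open>r \<in> Z\<close> by (intro ccontr[of "_ < _"]) (auto simp: dist_norm norm_minus_commute not_less)
  obtain v where v: "v \<in> Dom" "v \<noteq> 0" "A_til v = z *\<^sub>C v"
    using assms by (auto simp: eigenvalues_def)
  have vX: "v \<in> X" using v(1) dom_X by blast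
  have "P_inv.ext v = 0"
  proof (rule gersh.perturbed_eq_imp_trivial(2)[of _ z 0 0 "{}"])
    show "P_inv.ext v \<in> Dom" by (rule P_inv.ext_diag_dom[OF v(1)])
    show "(z - center (rep (snd x)) (fst x)) * fcoeff (P_inv.ext v) x + 0 * fcoeff 0 x
        = fcoeff (residual (P_inv.ext v)) x" for x
      using transported_eq[OF v(1) vX, of z 0 x] v(3) by simp
    show "radius (rep (snd x)) (fst x) < cmod (z - center (rep (snd x)) (fst x))" for x
      by (rule far[OF rep(1)])
  qed simp_all
  with v(2) vX P_inv_eq_0 show False by blast
qed

section \<open>Uniqueness and simplicity in the isolated disk\<close>

context
  fixes n0 :: "'m freq" and j0 :: 'p
  assumes n0: "n0 \<in> Z"
    and isolated: "\<And>r j. r \<in> Z \<Longrightarrow> (r, j) \<noteq> (n0, j0) \<Longrightarrow>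
       cball (center n0 j0) (radius n0 j0) \<inter> cball (center r j) (radius r j) = {}"
begin

abbreviation "disk0 \<equiv> cball (center n0 j0) (radius n0 j0)"
abbreviation "orb0 \<equiv> {x :: 'p \<times> 'm freq. fst x = j0 \<and> rep (snd x) = n0}"

text \<open>Disjointness makes the distance of the centers exceed the sum of the radii, and the
  triangle inequality through \<open>z\<close> splits that distance.\<close>

lemma isolated_gap:
  assumes z: "z \<in> disk0" and x: "x \<notin> orb0"
  shows "radius n0 j0 - cmod (z - center n0 j0) <
    cmod (z - center (rep (snd x)) (fst x)) - radius (rep (snd x)) (fst x)"
proof -
  let ?c = "center (rep (snd x)) (fst x)" and ?r = "radius (rep (snd x)) (fst x)"
  have "radius n0 j0 + ?r < dist (center n0 j0) ?c"
    using x by (intro cball_disjoint_imp_dist isolated rep(1) radius_nonneg) auto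
  also have "\<dots> \<le> dist (center n0 j0) z + dist z ?c" by (rule dist_triangle)
  finally show ?thesis by (simp add: dist_norm norm_minus_commute)
qed

lemma isolated_off_disk:
  assumes "z \<in> disk0" "x \<notin> orb0"
  shows "radius (rep (snd x)) (fst x) < cmod (z - center (rep (snd x)) (fst x))"
  using isolated_gap[OF assms] assms(1) by (simp add: dist_norm norm_minus_commute)

text \<open>Handles both uses at once: \<open>\<delta> = 0\<close> with two eigenvalues gives
  uniqueness, and \<open>z = z'\<close> with arbitrary \<open>\<delta>\<close> gives
  simplicity.\<close>

lemma generalized_eigenvector_in_isolated_disk:
  assumes v: "v \<in> Dom" "v \<noteq> 0" "A_til v = z' *\<^sub>C v" and z': "z' \<in> disk0"
    and w: "w \<in> Dom" "A_til w = z *\<^sub>C w + \<delta> *\<^sub>C v" and z: "z \<in> disk0"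
  obtains c where "w = c *\<^sub>C v" "\<delta> = c * (z' - z)"
proof -
  let ?v = "P_inv.ext v" and ?w = "P_inv.ext w"
  have X: "v \<in> X" "w \<in> X" "?v \<in> X" "?w \<in> X"
    using v(1) w(1) dom_X P_inv.ext_sym by blast+
  have v_dom: "?v \<in> Dom" by (rule P_inv.ext_diag_dom[OF v(1)])
  have v_eq: "(z' - center (rep (snd x)) (fst x)) * fcoeff ?v x = fcoeff (residual ?v) x" for x
    using transported_eq[OF v(1) X(1), of z' 0 x] v(3) by simp
  have v_nz: "?v \<noteq> 0" using P_inv_eq_0[OF X(1)] v(2) by blast
  have mass: "(\<Sum>\<^sub>\<infinity>x. if x \<in> orb0 then - cmod (fcoeff ?v x) else cmod (fcoeff ?v x)) < 0"
  proof (rule gersh.eigenvector_mass[OF v_dom v_nz v_eq])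
    show "0 \<le> radius n0 j0 - cmod (z' - center n0 j0)"
      using z' by (simp add: dist_norm norm_minus_commute)
  qed (use isolated_gap[OF z'] in auto)
  \<comment> \<open>A symmetric sequence has a single value on \<open>orb0\<close>, so one scalar
    suffices to cancel it there.\<close>
  have orb0: "fcoeff u x = fcoeff u (j0, n0)" if "u \<in> X" "x \<in> orb0" for u x
    using sym_rep[OF that(1), of "fst x" "snd x"] that(2) by auto
  \<comment> \<open>Otherwise \<open>?v\<close> would vanish on \<open>orb0\<close>, and the strict
    gaps elsewhere would make it 0.\<close>
  have a: "fcoeff ?v (j0, n0) \<noteq> 0"
  proof
    assume v0: "fcoeff ?v (j0, n0) = 0"
    have "?v = 0"
    proof (rule gersh.perturbed_eq_imp_trivial(2)[of ?v z' 0 0 orb0])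
      show "fcoeff ?v x = 0" if "x \<in> orb0" for x
        using orb0[OF X(3) that] v0 by (rule trans)
    qed (use v_dom v_eq isolated_off_disk[OF z'] in simp_all)
    with v_nz show False by blast
  qed
  \<comment> \<open>Chosen so that \<open>?w - c *\<^sub>C ?v\<close> vanishes on
    \<open>orb0\<close>.\<close>
  define c where "c = fcoeff ?w (j0, n0) / fcoeff ?v (j0, n0)"
  let ?u = "w - c *\<^sub>C v"
  have cv: "c *\<^sub>C v \<in> Dom" by (rule ell1.subspace_scale[OF subspace_dom v(1)])
  have u: "?u \<in> Dom" by (rule ell1.subspace_diff[OF subspace_dom w(1) cv])
  have uX: "?u \<in> X" using u dom_X by blast
  have "A_til ?u = A_til w - A_til (c *\<^sub>C v)"
    by (rule clinear_on_diff[OF A_til_linear subspace_dom w(1) cv])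
  also have "A_til (c *\<^sub>C v) = c *\<^sub>C A_til v"
    using A_til_linear v(1) unfolding clinear_on_def by blast
  finally have "A_til ?u = (z *\<^sub>C w + \<delta> *\<^sub>C v) - c *\<^sub>C z' *\<^sub>C v" unfolding v(3) w(2) .
  also have "\<dots> = z *\<^sub>C ?u + (\<delta> - c * (z' - z)) *\<^sub>C v"
    by (rule ell1_eqI) (simp add: algebra_simps)
  finally have eq: "A_til ?u = z *\<^sub>C ?u + (\<delta> - c * (z' - z)) *\<^sub>C v" .
  have "P_inv.ext ?u = ?w - P_inv.ext (c *\<^sub>C v)"
    using cv dom_X by (intro clinear_on_diff[OF P_inv.ext_linear subspace_sym X(2)]) blast
  also have "P_inv.ext (c *\<^sub>C v) = c *\<^sub>C ?v"
    using P_inv.ext_linear X(1) unfolding clinear_on_def by blast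
  finally have Pu: "P_inv.ext ?u = ?w - c *\<^sub>C ?v" .
  have vanish: "fcoeff (P_inv.ext ?u) x = 0" if "x \<in> orb0" for x
    unfolding Pu using orb0[OF X(3) that] orb0[OF X(4) that] a by (simp add: c_def)
  \<comment> \<open>The correction replaces the source coefficient by
    \<open>\<delta> - c * (z' - z)\<close>; the source \<open>?v\<close> has the required negative
    sum by \<open>mass\<close>.\<close>
  have trivial: "\<delta> - c * (z' - z) = 0" "P_inv.ext ?u = 0"
    by (rule gersh.perturbed_eq_imp_trivial[where v = "P_inv.ext ?u" and x = ?v and z = z and S = orb0
          and \<delta> = "\<delta> - c * (z' - z)"],
        rule P_inv.ext_diag_dom[OF u], rule transported_eq[OF u X(1) eq],
        erule vanish, erule isolated_off_disk[OF z], rule mass)+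
  have "?u = 0" by (rule P_inv_eq_0[OF uX trivial(2)])
  then have "w = c *\<^sub>C v" by simp
  moreover have "\<delta> = c * (z' - z)" using trivial(1) by simp
  ultimately show thesis by (rule that)
qed

lemma isolated_eigenvalue_unique:
  assumes "z \<in> eigenvalues Dom A_til" "z' \<in> eigenvalues Dom A_til" "z \<in> disk0" "z' \<in> disk0"
  shows "z = z'"
proof -
  obtain v w where v: "v \<in> Dom" "v \<noteq> 0" "A_til v = z' *\<^sub>C v"
    and w: "w \<in> Dom" "w \<noteq> 0" "A_til w = z *\<^sub>C w"
    using assms(1,2) by (auto simp: eigenvalues_def)
  have "A_til w = z *\<^sub>C w + 0 *\<^sub>C v" using w(3) by simp
  from generalized_eigenvector_in_isolated_disk[OF v assms(4) w(1) this assms(3)]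
  obtain c where "w = c *\<^sub>C v" "0 = c * (z' - z)" .
  with w(2) show "z = z'" by auto
qed

text \<open>By induction every generalized eigenvector is a multiple of \<open>v\<close>: one step
  back it lies in the span of \<open>v\<close>, which is the situation with source
  \<open>\<delta> *\<^sub>C v\<close>.\<close>

lemma isolated_eigenvalue_simple:
  assumes z: "z \<in> eigenvalues Dom A_til" "z \<in> disk0"
  shows "algebraically_simple Dom A_til z"
proof -
  obtain v where v: "v \<in> Dom" "v \<noteq> 0" "A_til v = z *\<^sub>C v"
    using z(1) by (auto simp: eigenvalues_def)
  have "ker_pow Dom A_til z k \<subseteq> ell1.span {v}" for k
  proof (induction k)
    case (Suc k)
    show ?case
    proof
      fix w assume "w \<in> ker_pow Dom A_til z (Suc k)"
      then have w: "w \<in> Dom" "A_til w - z *\<^sub>C w \<in> ell1.span {v}" using Suc by auto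
      then obtain \<delta> where "A_til w - z *\<^sub>C w = \<delta> *\<^sub>C v" by (auto simp: ell1.span_singleton)
      then have "A_til w = z *\<^sub>C w + \<delta> *\<^sub>C v" by (simp add: diff_eq_eq add.commute)
      from generalized_eigenvector_in_isolated_disk[OF v z(2) w(1) this z(2)]
      show "w \<in> ell1.span {v}" by (metis ell1.span_base ell1.span_scale singletonI)
    qed
  qed (simp add: ell1.span_zero)
  \<comment> \<open>The exponent starts at \<open>Suc 0\<close>, because \<open>ker_pow\<close> at 0
    is the zero space.\<close>
  moreover have "ell1.span {v} \<subseteq> ker_pow Dom A_til z (Suc 0)"
    using A_til_linear v ell1.subspace_scale[OF subspace_dom]
    by (auto simp: ell1.span_singleton clinear_on_def mult.commute)
  ultimately have "(\<Union>k. ker_pow Dom A_til z k) = ell1.span {v}" by blast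
  then show ?thesis
    using v(2) by (simp add: algebraically_simple_def ell1.dim_eq_card_independent)
qed

end

end

section \<open>Spectrum of the linearization at the exact solution\<close>

theorem proposition2p2:
  fixes G :: "('g, 'b) monoid_scheme"
    and \<phi> :: "'g \<Rightarrow> 'm::finite freq \<Rightarrow> 'm freq"
    and Z\<^sub>r :: "'m freq set"
    and N :: nat
    and l :: "'l::real_normed_vector \<Rightarrow> 'p::finite \<Rightarrow> 'm freq \<Rightarrow> complex"
    and g :: "'l \<Rightarrow> ('p \<times> 'm freq) ell1 \<Rightarrow> ('p \<times> 'm freq) ell1"
    and lam_bar lam_til :: 'l
    and u_bar u_til :: "('p \<times> 'm freq) ell1"
    and Dg_bar Dg_til PN PN_inv :: "('p \<times> 'm freq) ell1 \<Rightarrow> ('p \<times> 'm freq) ell1"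
    and q :: "'p \<Rightarrow> 'p \<Rightarrow> 'm freq ell1"
    and r0 eps :: real
    and n0 :: "'m freq" and j0 :: 'p
  defines "X \<equiv> (sym_ell1 G \<phi> :: ('p \<times> 'm freq) ell1 set)"
    and "Pi_low \<equiv> (proj G \<phi> (idx Z\<^sub>r N) :: ('p \<times> 'm freq) ell1 \<Rightarrow> _)"
  defines "dom_bar \<equiv> diag_dom X (l lam_bar)"
    and "dom_til \<equiv> diag_dom X (l lam_til)"
    and "Df_bar \<equiv> lin_op (l lam_bar) Dg_bar"
    and "Df_til \<equiv> lin_op (l lam_til) Dg_til"
  defines "d \<equiv> gershgorin_center G \<phi> Z\<^sub>r N PN PN_inv Df_bar"
    and "\<rho> \<equiv> gershgorin_radius G \<phi> Z\<^sub>r N PN PN_inv Df_bar Dg_bar q eps"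
  assumes action: "linear_lattice_action G \<phi>"
    and reps: "orbit_representatives G \<phi> Z\<^sub>r"
    and compatible: "cutoff_compatible G \<phi> Z\<^sub>r N"
    and symbol: "\<And>mu j. orbit_constant G \<phi> (l mu j)"
    and g_maps: "\<And>mu u. u \<in> X \<Longrightarrow> g mu u \<in> X"
    and u_bar: "u_bar \<in> X" "Pi_low u_bar = u_bar"
    and Dg_bar: "(g lam_bar has_derivative Dg_bar) (at u_bar within X)" "clinear_on X Dg_bar"
    and Dg_til: "(g lam_til has_derivative Dg_til) (at u_til within X)" "clinear_on X Dg_til"
    and sectorialam_bar: "sectorial X dom_bar Df_bar" "compact_resolvent X dom_bar Df_bar"
    and sectorialam_til: "sectorial X dom_til Df_til" "compact_resolvent X dom_til Df_til"
    and q_sym: "\<And>i j. orbit_constant G \<phi> (fcoeff (q i j))"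
    and q_supp: "\<And>i j n. n \<in> Z\<^sub>r - idx Z\<^sub>r (2 * N) \<Longrightarrow> fcoeff (q i j) n = 0"
    and Dg_blocks: "\<And>v i k. v \<in> X \<Longrightarrow>
       fcoeff (Dg_bar v) (i, k) = (\<Sum>j\<in>UNIV. conv (fcoeff (q i j)) (\<lambda>n. fcoeff v (j, n)) k)"
    and u_til: "u_til \<in> dom_til" "diag_op (l lam_til) u_til + g lam_til u_til = 0"
    and within_r0: "norm (lam_til - lam_bar) \<le> r0" "norm (u_til - u_bar) \<le> r0"
    and kernel: "\<exists>v\<in>dom_til. v \<noteq> 0 \<and> Df_til v = 0"
    and eps: "\<And>v. v \<in> dom_bar \<inter> dom_til \<Longrightarrow> norm (Df_til v - Df_bar v) \<le> eps * norm v"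
    and PN: "finite_block X Pi_low PN" "finite_block X Pi_low PN_inv"
      "\<And>v. v \<in> X \<Longrightarrow> PN_inv (PN v) = Pi_low v" "\<And>v. v \<in> X \<Longrightarrow> PN (PN_inv v) = Pi_low v"
    and i: "n0 \<in> idx Z\<^sub>r (3 * N)"
      "\<And>n j. n \<in> idx Z\<^sub>r (3 * N) \<Longrightarrow> \<bar>Re (d n j)\<bar> > \<rho> n j \<longleftrightarrow> (n, j) \<noteq> (n0, j0)"
    and ii: "\<And>j. (SUP n\<in>Z\<^sub>r - idx Z\<^sub>r (3 * N). ereal (Re (d n j))) + ereal (col_norm q j)
          + ereal (radius_inf G \<phi> PN PN_inv eps) < 0"
    and iii: "\<And>n j. n \<in> Z\<^sub>r \<Longrightarrow> (n, j) \<noteq> (n0, j0) \<Longrightarrow>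
       cball (d n0 j0) (\<rho> n0 j0) \<inter> cball (d n j) (\<rho> n j) = {}"
  shows "{z \<in> eigenvalues dom_til Df_til. Re z = 0} = {0}
    \<and> algebraically_simple dom_til Df_til 0
    \<and> (\<forall>z \<in> eigenvalues dom_til Df_til - {0}. Re z \<noteq> 0)
    \<and> ((\<forall>n \<in> idx Z\<^sub>r (3 * N). \<forall>j. (n, j) \<noteq> (n0, j0) \<longrightarrow> Re (d n j) + \<rho> n j < 0) \<longrightarrow>
        finite {z \<in> eigenvalues dom_til Df_til. Re z > 0} \<and>
        card {z \<in> eigenvalues dom_til Df_til. Re z > 0} = 0)"
proof -
  interpret symmetric_lattice G \<phi> Z\<^sub>r
    by standard (rule action, rule reps)
  have u_bar_til: "u_bar \<in> sym_ell1 G \<phi>" "u_til \<in> sym_ell1 G \<phi>"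
    using u_bar(1) u_til(1) by (simp_all add: X_def dom_til_def diag_dom_def)
  note X_simps = X_def dom_bar_def dom_til_def Df_bar_def Df_til_def Pi_low_def
  interpret pseudo_diagonalization G \<phi> Z\<^sub>r N q "l lam_bar" "l lam_til" Dg_bar Dg_til PN PN_inv eps
  proof (intro pseudo_diagonalization.intro pseudo_diagonalization_axioms.intro)
    show "symmetric_lattice G \<phi> Z\<^sub>r" by unfold_locales
    show "block_convolution G \<phi> Z\<^sub>r N q Dg_bar"
      by unfold_locales
        (use compatible q_sym q_supp Dg_bar(2) Dg_blocks in \<open>simp_all only: X_simps\<close>)
    show "low_block G \<phi> Z\<^sub>r N PN" "low_block G \<phi> Z\<^sub>r N PN_inv"
      by (unfold_locales; use PN(1,2) in \<open>simp only: X_simps\<close>)+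
    \<comment> \<open>Invariance of the derivatives follows from that of \<open>g\<close>, by
      differentiating at the symmetric points \<open>u_bar\<close> and \<open>u_til\<close>.\<close>
    show "Dg_bar v \<in> sym_ell1 G \<phi>" "Dg_til v \<in> sym_ell1 G \<phi>" if "v \<in> sym_ell1 G \<phi>" for v
      by (rule derivative_sym[where g = "g lam_bar" and u = u_bar],
          use g_maps Dg_bar(1) u_bar_til that in \<open>simp_all only: X_simps\<close>)
         (rule derivative_sym[where g = "g lam_til" and u = u_til],
          use g_maps Dg_til(1) u_bar_til that in \<open>simp_all only: X_simps\<close>)
    \<comment> \<open>Boundedness is part of being a derivative.\<close>
    show "\<exists>C. \<forall>v\<in>sym_ell1 G \<phi>. norm (Dg_til v) \<le> C * norm v"
      using bounded_linear.bounded[OF has_derivative_bounded_linear[OF Dg_til(1)]]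
      by (metis mult.commute)
  qed (use PN(4) symbol Dg_til(2) eps in \<open>simp_all only: X_simps\<close>)
  have Df: "dom_til = Dom" "Df_til = A_til" by (simp_all add: X_simps)
  have d: "d n j = center n j" and rho: "\<rho> n j = radius n j" for n j
    by (simp_all add: d_def \<rho>_def Df_bar_def)
  have n0: "n0 \<in> Z\<^sub>r" using i(1) by (simp add: idx_def)
  note iso = n0 iii[unfolded d rho]
  have far: "Re (center n j) + radius n j < 0" if n: "n \<in> Z\<^sub>r - idx Z\<^sub>r (3 * N)" for n j
  proof -
    have "n \<notin> idx Z\<^sub>r N" using n by (auto simp: idx_def)
    then have "radius n j = col_norm q j + r_inf" using n by (simp add: gershgorin_radius_def)
    \<comment> \<open>In the extended reals the supremum dominates each of its terms without any
      boundedness condition, so (ii) applies index by index.\<close>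
    moreover have "ereal (Re (d n j)) + ereal (col_norm q j) + ereal r_inf < 0"
      using SUP_upper[OF n, of "\<lambda>n. ereal (Re (d n j))"]
      by (intro le_less_trans[OF _ ii[of j]] add_right_mono)
    ultimately show ?thesis by (simp add: d)
  qed
  have left: "Re z < 0" if "z \<in> cball (center n j) (radius n j)" "Re (center n j) + radius n j < 0" for z n j
    using that abs_Re_le_cmod[of "z - center n j"] by (simp add: dist_norm norm_minus_commute)
  have off_axis: "Re z \<noteq> 0" if "z \<in> cball (center n j) (radius n j)" "n \<in> Z\<^sub>r" "(n, j) \<noteq> (n0, j0)" for z n j
  proof (cases "n \<in> idx Z\<^sub>r (3 * N)")
    case True
    then have "radius n j < \<bar>Re (center n j)\<bar>" using i(2) that(3) by (simp add: d rho)
    then show ?thesis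
      using that(1) abs_Re_le_cmod[of "z - center n j"] by (auto simp: dist_norm norm_minus_commute)
  next
    case False
    then show ?thesis using left[OF that(1) far] that(2) by simp
  qed
  \<comment> \<open>Some disk contains the eigenvalue, and every disk except the isolated one avoids
    the imaginary axis.\<close>
  have on_axis: "z \<in> cball (center n0 j0) (radius n0 j0)" if z: "z \<in> eigenvalues Dom A_til" "Re z = 0" for z
  proof -
    obtain n j where nj: "n \<in> Z\<^sub>r" "z \<in> cball (center n j) (radius n j)"
      by (rule eigenvalue_in_disk[OF z(1)])
    with off_axis[OF nj(2,1)] z(2) show ?thesis by auto
  qed
  have zero: "0 \<in> eigenvalues Dom A_til"
    using kernel by (auto simp: eigenvalues_def Df)
  \<comment> \<open>The kernel vector makes 0 an eigenvalue on the axis, so 0 is the one eigenvalue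
    that the isolated disk can hold.\<close>
  have zero_disk: "0 \<in> cball (center n0 j0) (radius n0 j0)" by (rule on_axis[OF zero]) simp
  have unique: "z = 0" if "z \<in> eigenvalues Dom A_til" "z \<in> cball (center n0 j0) (radius n0 j0)" for z
    by (rule isolated_eigenvalue_unique[OF iso that(1) zero that(2) zero_disk])
  have axis: "{z \<in> eigenvalues Dom A_til. Re z = 0} = {0}"
    using zero unique on_axis by auto
  have simple: "algebraically_simple Dom A_til 0"
    by (rule isolated_eigenvalue_simple[OF iso zero zero_disk])
  \<comment> \<open>Under (iv) and (ii) all other disks lie in the open left half-plane, and the
    isolated one contributes only 0.\<close>
  have stable: "{z \<in> eigenvalues Dom A_til. Re z > 0} = {}"
    if iv: "\<forall>n\<in>idx Z\<^sub>r (3 * N). \<forall>j. (n, j) \<noteq> (n0, j0) \<longrightarrow> Re (d n j) + \<rho> n j < 0"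
  proof -
    have False if z: "z \<in> eigenvalues Dom A_til" "Re z > 0" for z
    proof -
      obtain n j where nj: "n \<in> Z\<^sub>r" "z \<in> cball (center n j) (radius n j)"
        by (rule eigenvalue_in_disk[OF z(1)])
      show False
      proof (cases "(n, j) = (n0, j0)")
        case True
        with unique[OF z(1)] nj(2) z(2) show False by simp
      next
        case False
        then have "Re (center n j) + radius n j < 0"
          using iv far nj(1) by (cases "n \<in> idx Z\<^sub>r (3 * N)") (auto simp: d rho)
        with left[OF nj(2)] z(2) show False by simp
      qed
    qed
    then show ?thesis by blast
  qed
  show ?thesis
    unfolding Df
  proof (intro conjI impI)
    show "\<forall>z\<in>eigenvalues Dom A_til - {0}. Re z \<noteq> 0" using axis by blast
    assume "\<forall>n\<in>idx Z\<^sub>r (3 * N). \<forall>j. (n, j) \<noteq> (n0, j0) \<longrightarrow> Re (d n j) + \<rho> n j < 0"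
    note empty = stable[OF this]
    \<comment> \<open>Finiteness is recorded separately, because \<open>card\<close> of an infinite
      set is also 0.\<close>
    show "finite {z \<in> eigenvalues Dom A_til. Re z > 0}"
      and "card {z \<in> eigenvalues Dom A_til. Re z > 0} = 0"
      by (simp_all only: empty finite.emptyI card.empty)
  qed (rule axis simple)+
qed

end
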